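(* For a commutative ring $R$ write $\mathrm{TS}(R)=\mathrm{Top}(\mathrm{Spec}(R))$. (1) Let $X$ be a topological space and $Y$ a subset of $X$. Then $\mathrm{Top}(Y)$, where $Y$ has the subspace topology, is canonically isomorphic to $\overline{Q(\mathrm{Top}(X),\mathfrak{P}_Y)}$. (2) Let $R$ be a commutative ring, let $S\subset R$ be a multiplicative set, and let $Y(S)=\{\mathfrak{p}\in\mathrm{Spec}(R)\mid S\cap\mathfrak{p}=\emptyset\}$. Then $\mathrm{TS}(S^{-1}R)$ is canonically isomorphic to $\overline{Q(\mathrm{TS}(R),\mathfrak{P}_{Y(S)})}$. (3) Let $R$ be a commutative ring, let $\mathfrak{p}$ be a prime ideal in $R$, and let $S=R\setminus\mathfrak{p}$. Let $Y(\mathfrak{p})=\{\mathfrak{q}\in\mathrm{Spec}(R)\mid\mathfrak{q}\subset\mathfrak{p}\}$. Then $\mathrm{TS}(R_{\mathfrak{p}})$ is canonically isomorphic to $\overline{Q(\mathrm{TS}(R),\mathfrak{P}_{Y(\mathfrak{p})})}$.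
   Context: For a topological space $X$, $\mathrm{Top}(X)$ is the category whose objects are the open subsets of $X$ and whose morphisms are the inclusions. $\mathrm{Spec}$ carries the Zariski topology. Path structure. Put $C=\mathrm{Top}(X)$. Let $\Gamma$ be the set of functions $\gamma:[0,1]\to\mathrm{Ob}(C)$ obtained as follows: for some $n\ge1$, a partition of $[0,1]$ into subintervals $I_0,\dots,I_n$ listed in increasing order, and open sets $U_0\subseteq U_1\subseteq\cdots\subseteq U_n$, put $\gamma(t)=U_i$ for $t\in I_i$. Put $\gamma\sim\gamma'$ iff $\gamma(0)=\gamma'(0)$ and $\gamma(1)=\gamma'(1)$, and write $[\gamma]$ for the class. Then $C$ is the category with objects $\mathrm{Ob}(C)$, morphisms $U\to V$ the classes $[\gamma]$ with $\gamma(0)=U$, $\gamma(1)=V$, and composition by concatenation. The partition $\mathfrak{P}_Y$. For $Y\subseteq X$ and $Z\subseteq Y$ let $A_Z=\{U\in\mathrm{Ob}(C)\mid U\cap Y=Z\}$. $\mathfrak{P}_Y$ is the partition of $\mathrm{Ob}(C)$ into the nonempty sets $A_Z$; its elements are called pixels. Pixelation. $\Sigma_{\mathfrak{P}_Y}$ is the class of morphisms $[\rho]$ of $C$ with $\mathrm{im}(\rho)$ contained in one pixel; it admits a two-sided calculus of fractions, giving $C[\Sigma_{\mathfrak{P}_Y}^{-1}]$. Choose an object $s_{\mathsf{X}}$ in each pixel $\mathsf{X}$. A pseudo arrow is a morphism $[\rho]^{-1}[\gamma]$ of $C[\Sigma_{\mathfrak{P}_Y}^{-1}]$ with $[\rho]\in\Sigma_{\mathfrak{P}_Y}$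 such that $[0,1]$ can be partitioned into exactly two subintervals which $\gamma$ maps into two distinct pixels respectively. $Q(C,\mathfrak{P}_Y)$ is the quiver with vertices the pixels and arrows $\mathsf{X}\to\mathsf{X}'$ the pseudo arrows $s_{\mathsf{X}}\to s_{\mathsf{X}'}$ (at most one). Let $\Psi$ be the functor from the free category on this quiver to $C[\Sigma_{\mathfrak{P}_Y}^{-1}]$, $\mathsf{X}\mapsto s_{\mathsf{X}}$, sending each arrow to its pseudo arrow; $\overline{Q(C,\mathfrak{P}_Y)}$ is the quotient of the free category identifying parallel morphisms $f,g$ with $\Psi(f)=\Psi(g)$. (It is a skeleton of $C[\Sigma_{\mathfrak{P}_Y}^{-1}]$.) "Canonically isomorphic" means isomorphic as categories via the assignment $A_Z\leftrightarrow Z$ on objects, combined in (2) and (3) with the canonical homeomorphisms $\mathrm{Spec}(S^{-1}R)\cong Y(S)$ and $\mathrm{Spec}(R_{\mathfrak{p}})\cong Y(\mathfrak{p})$. *)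

theory Defs
  imports "HOL-Algebra.Ideal" "HOL-Analysis.Analysis" "Graph_Theory.Arc_Walk"
begin

section \<open>Categories\<close>

text \<open>\<open>Comp C g f\<close> is \<open>g\<close> after \<open>f\<close>.\<close>

record ('o, 'm) cat =
  Ob :: "'o set"
  Mor :: "'o \<Rightarrow> 'o \<Rightarrow> 'm set"
  Ident :: "'o \<Rightarrow> 'm"
  Comp :: "'m \<Rightarrow> 'm \<Rightarrow> 'm"

locale category =
  fixes C :: "('o, 'm) cat"
  assumes Mor_disjoint:
      "\<lbrakk>a \<in> Ob C; b \<in> Ob C; a' \<in> Ob C; b' \<in> Ob C; f \<in> Mor C a b; f \<in> Mor C a' b'\<rbrakk>
       \<Longrightarrow> a = a' \<and> b = b'"
    and Ident_Mor: "a \<in> Ob C \<Longrightarrow> Ident C a \<in> Mor C a a"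
    and Comp_Mor:
      "\<lbrakk>a \<in> Ob C; b \<in> Ob C; c \<in> Ob C; f \<in> Mor C a b; g \<in> Mor C b c\<rbrakk> \<Longrightarrow> Comp C g f \<in> Mor C a c"
    and Comp_Ident: "\<lbrakk>a \<in> Ob C; b \<in> Ob C; f \<in> Mor C a b\<rbrakk> \<Longrightarrow> Comp C f (Ident C a) = f"
    and Ident_Comp: "\<lbrakk>a \<in> Ob C; b \<in> Ob C; f \<in> Mor C a b\<rbrakk> \<Longrightarrow> Comp C (Ident C b) f = f"
    and Comp_assoc:
      "\<lbrakk>a \<in> Ob C; b \<in> Ob C; c \<in> Ob C; d \<in> Ob C; f \<in> Mor C a b; g \<in> Mor C b c; h \<in> Mor C c d\<rbrakk>
       \<Longrightarrow> Comp C h (Comp C g f) = Comp C (Comp C h g) f"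

locale cat_functor = source: category C + target: category D
  for C :: "('o, 'm) cat" and D :: "('p, 'n) cat" +
  fixes F0 :: "'o \<Rightarrow> 'p" and F1 :: "'m \<Rightarrow> 'n"
  assumes F0_Ob: "a \<in> Ob C \<Longrightarrow> F0 a \<in> Ob D"
    and F1_Mor: "\<lbrakk>a \<in> Ob C; b \<in> Ob C; f \<in> Mor C a b\<rbrakk> \<Longrightarrow> F1 f \<in> Mor D (F0 a) (F0 b)"
    and F1_Ident: "a \<in> Ob C \<Longrightarrow> F1 (Ident C a) = Ident D (F0 a)"
    and F1_Comp:
      "\<lbrakk>a \<in> Ob C; b \<in> Ob C; c \<in> Ob C; f \<in> Mor C a b; g \<in> Mor C b c\<rbrakk>
       \<Longrightarrow> F1 (Comp C g f) = Comp D (F1 g) (F1 f)"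

definition cat_isomorphism ::
  "('o, 'm) cat \<Rightarrow> ('p, 'n) cat \<Rightarrow> ('o \<Rightarrow> 'p) \<Rightarrow> ('m \<Rightarrow> 'n) \<Rightarrow> bool" where
  "cat_isomorphism C D F0 F1 \<longleftrightarrow>
     cat_functor C D F0 F1 \<and>
     (\<exists>G0 G1. cat_functor D C G0 G1 \<and>
        (\<forall>a \<in> Ob C. G0 (F0 a) = a) \<and> (\<forall>x \<in> Ob D. F0 (G0 x) = x) \<and>
        (\<forall>a \<in> Ob C. \<forall>b \<in> Ob C. \<forall>f \<in> Mor C a b. G1 (F1 f) = f) \<and>
        (\<forall>x \<in> Ob D. \<forall>y \<in> Ob D. \<forall>g \<in> Mor D x y. F1 (G1 g) = g))"


subsection \<open>Localization by left fractions\<close>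

text \<open>The pair \<open>(f, s)\<close>, with \<open>f : U \<rightarrow> A\<close> and \<open>s : V \<rightarrow> A\<close> in \<open>W\<close>, represents
  \<open>s\<^sup>-\<^sup>1 f : U \<rightarrow> V\<close>.\<close>

definition left_fractions :: "('o, 'm) cat \<Rightarrow> 'm set \<Rightarrow> 'o \<Rightarrow> 'o \<Rightarrow> ('m \<times> 'm) set" where
  "left_fractions C W U V = {(f, s). \<exists>A \<in> Ob C. f \<in> Mor C U A \<and> s \<in> Mor C V A \<and> s \<in> W}"

definition fraction_rel ::
  "('o, 'm) cat \<Rightarrow> 'm set \<Rightarrow> 'o \<Rightarrow> 'o \<Rightarrow> (('m \<times> 'm) \<times> ('m \<times> 'm)) set" where
  "fraction_rel C W U V =
     {((f, s), (f', s')). (f, s) \<in> left_fractions C W U V \<and> (f', s') \<in> left_fractions C W U V \<and>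
        (\<exists>A \<in> Ob C. \<exists>A' \<in> Ob C. \<exists>B \<in> Ob C. \<exists>a \<in> Mor C A B. \<exists>a' \<in> Mor C A' B.
           f \<in> Mor C U A \<and> s \<in> Mor C V A \<and> f' \<in> Mor C U A' \<and> s' \<in> Mor C V A' \<and>
           Comp C a f = Comp C a' f' \<and> Comp C a s = Comp C a' s' \<and> Comp C a s \<in> W)}"

definition fraction :: "('o, 'm) cat \<Rightarrow> 'm set \<Rightarrow> 'o \<Rightarrow> 'o \<Rightarrow> 'm \<Rightarrow> 'm \<Rightarrow> ('m \<times> 'm) set" where
  "fraction C W U V f s = fraction_rel C W U V `` {(f, s)}"

text \<open>A composite \<open>t\<^sup>-\<^sup>1 g s\<^sup>-\<^sup>1 f\<close> is \<open>(u t)\<^sup>-\<^sup>1 (h f)\<close> for any completion \<open>h s = u g\<close> with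
  \<open>u\<close> in \<open>W\<close>.  When \<open>W\<close> admits a calculus of left fractions, the class obtained depends neither on
  the completion nor on the representatives, so that the union below is that single class.\<close>

definition localize :: "('o, 'm) cat \<Rightarrow> 'm set \<Rightarrow> ('o, ('m \<times> 'm) set) cat" where
  "localize C W = \<lparr>
     Ob = Ob C,
     Mor = (\<lambda>U V. left_fractions C W U V // fraction_rel C W U V),
     Ident = (\<lambda>U. fraction C W U U (Ident C U) (Ident C U)),
     Comp = (\<lambda>\<psi> \<phi>. \<Union>{fraction C W U Z (Comp C h f) (Comp C u t) | U V Z A B P f s g t h u.
        {U, V, Z, A, B, P} \<subseteq> Ob C \<and>
        (f, s) \<in> \<phi> \<and> f \<in> Mor C U A \<and> s \<in> Mor C V A \<and>
        (g, t) \<in> \<psi> \<and> g \<in> Mor C V B \<and> t \<in> Mor C Z B \<and>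
        h \<in> Mor C A P \<and> u \<in> Mor C B P \<and> u \<in> W \<and> Comp C h s = Comp C u g}) \<rparr>"


subsection \<open>Free categories on quivers and their quotients\<close>

definition free_cat :: "('v, 'e) pre_digraph \<Rightarrow> ('v, 'v \<times> 'e list \<times> 'v) cat" where
  "free_cat G = \<lparr>
     Ob = verts G,
     Mor = (\<lambda>u v. {(u, p, v) | p. pre_digraph.awalk G u p v}),
     Ident = (\<lambda>u. (u, [], u)),
     Comp = (\<lambda>(_, q, w) (u, p, _). (u, p @ q, w)) \<rparr>"

text \<open>The morphism map of the functor out of a free category that is given by \<open>F0\<close> on vertices
  and by \<open>F1\<close> on arrows.\<close>

definition free_extension ::
  "('o, 'm) cat \<Rightarrow> ('v \<Rightarrow> 'o) \<Rightarrow> ('e \<Rightarrow> 'm) \<Rightarrow> 'v \<times> 'e list \<times> 'v \<Rightarrow> 'm" where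
  "free_extension D F0 F1 = (\<lambda>(u, p, v). foldl (\<lambda>m e. Comp D (F1 e) m) (Ident D (F0 u)) p)"

definition parallel_rel :: "('o, 'm) cat \<Rightarrow> ('m \<Rightarrow> 'n) \<Rightarrow> 'o \<Rightarrow> 'o \<Rightarrow> ('m \<times> 'm) set" where
  "parallel_rel C F1 a b = {(f, g). f \<in> Mor C a b \<and> g \<in> Mor C a b \<and> F1 f = F1 g}"

definition quotient_cat :: "('o, 'm) cat \<Rightarrow> ('m \<Rightarrow> 'n) \<Rightarrow> ('o, 'm set) cat" where
  "quotient_cat C F1 = \<lparr>
     Ob = Ob C,
     Mor = (\<lambda>a b. Mor C a b // parallel_rel C F1 a b),
     Ident = (\<lambda>a. parallel_rel C F1 a a `` {Ident C a}),
     Comp = (\<lambda>\<psi> \<phi>. \<Union>{parallel_rel C F1 a c `` {Comp C g f} | a b c f g.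
        {a, b, c} \<subseteq> Ob C \<and> f \<in> \<phi> \<and> f \<in> Mor C a b \<and> g \<in> \<psi> \<and> g \<in> Mor C b c}) \<rparr>"


section \<open>The category of open sets and its path structure\<close>

definition Top :: "'a topology \<Rightarrow> ('a set, 'a set \<times> 'a set) cat" where
  "Top X = \<lparr>
     Ob = {U. openin X U},
     Mor = (\<lambda>U V. {(U', V'). U' = U \<and> V' = V \<and> openin X U \<and> openin X V \<and> U \<subseteq> V}),
     Ident = (\<lambda>U. (U, U)),
     Comp = (\<lambda>(_, W) (U, _). (U, W)) \<rparr>"

definition open_paths :: "'a topology \<Rightarrow> (real \<Rightarrow> 'a set) set" where
  "open_paths X = {\<gamma> \<in> extensional {0..1}. \<exists>n \<ge> 1. \<exists>(I :: nat \<Rightarrow> real set) (U :: nat \<Rightarrow> 'a set).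
     (\<forall>i \<le> n. is_interval (I i) \<and> I i \<noteq> {}) \<and>
     (\<Union>i \<le> n. I i) = {0..1} \<and>
     (\<forall>i j. i < j \<and> j \<le> n \<longrightarrow> (\<forall>x \<in> I i. \<forall>y \<in> I j. x < y)) \<and>
     (\<forall>i \<le> n. openin X (U i)) \<and>
     (\<forall>i < n. U i \<subseteq> U (Suc i)) \<and>
     (\<forall>i \<le> n. \<forall>t \<in> I i. \<gamma> t = U i)}"

definition path_class :: "'a topology \<Rightarrow> (real \<Rightarrow> 'a set) \<Rightarrow> (real \<Rightarrow> 'a set) set" where
  "path_class X \<gamma> = {\<gamma>' \<in> open_paths X. \<gamma>' 0 = \<gamma> 0 \<and> \<gamma>' 1 = \<gamma> 1}"

definition path_concat :: "(real \<Rightarrow> 'a set) \<Rightarrow> (real \<Rightarrow> 'a set) \<Rightarrow> real \<Rightarrow> 'a set" where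
  "path_concat \<gamma> \<delta> = restrict (\<lambda>t. if t \<le> 1/2 then \<gamma> (2 * t) else \<delta> (2 * t - 1)) {0..1}"

text \<open>\<open>Top X\<close> presented by paths.  In the composite all the united classes coincide, since they
  have the same endpoints.\<close>

definition path_cat :: "'a topology \<Rightarrow> ('a set, (real \<Rightarrow> 'a set) set) cat" where
  "path_cat X = \<lparr>
     Ob = {U. openin X U},
     Mor = (\<lambda>U V. {path_class X \<gamma> | \<gamma>. \<gamma> \<in> open_paths X \<and> \<gamma> 0 = U \<and> \<gamma> 1 = V}),
     Ident = (\<lambda>U. path_class X (restrict (\<lambda>_. U) {0..1})),
     Comp = (\<lambda>g f. \<Union>{path_class X (path_concat \<gamma> \<delta>) | \<gamma> \<delta>. \<gamma> \<in> f \<and> \<delta> \<in> g \<and> \<gamma> 1 = \<delta> 0}) \<rparr>"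


section \<open>Pixelation\<close>

definition pixel :: "'a topology \<Rightarrow> 'a set \<Rightarrow> 'a set \<Rightarrow> 'a set set" where
  "pixel X Y Z = {U. openin X U \<and> U \<inter> Y = Z}"

definition pixels :: "'a topology \<Rightarrow> 'a set \<Rightarrow> 'a set set set" where
  "pixels X Y = {pixel X Y Z | Z. Z \<subseteq> Y \<and> pixel X Y Z \<noteq> {}}"

definition pixel_maps :: "'a topology \<Rightarrow> 'a set set set \<Rightarrow> (real \<Rightarrow> 'a set) set set" where
  "pixel_maps X \<PP> = {path_class X \<rho> | \<rho>. \<rho> \<in> open_paths X \<and> (\<exists>P \<in> \<PP>. \<rho> ` {0..1} \<subseteq> P)}"

abbreviation pixel_localization ::
  "'a topology \<Rightarrow> 'a set set set \<Rightarrow>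
     ('a set, ((real \<Rightarrow> 'a set) set \<times> (real \<Rightarrow> 'a set) set) set) cat" where
  "pixel_localization X \<PP> \<equiv> localize (path_cat X) (pixel_maps X \<PP>)"

definition pseudo_arrows ::
  "'a topology \<Rightarrow> 'a set set set \<Rightarrow> 'a set \<Rightarrow> 'a set \<Rightarrow>
     ((real \<Rightarrow> 'a set) set \<times> (real \<Rightarrow> 'a set) set) set set" where
  "pseudo_arrows X \<PP> U V =
     {fraction (path_cat X) (pixel_maps X \<PP>) U V (path_class X \<gamma>) (path_class X \<rho>) | \<gamma> \<rho>.
        \<gamma> \<in> open_paths X \<and> \<rho> \<in> open_paths X \<and> \<gamma> 0 = U \<and> \<rho> 0 = V \<and> \<gamma> 1 = \<rho> 1 \<and>
        path_class X \<rho> \<in> pixel_maps X \<PP> \<and>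
        (\<exists>I J. is_interval I \<and> is_interval J \<and> I \<noteq> {} \<and> J \<noteq> {} \<and> I \<inter> J = {} \<and> I \<union> J = {0..1} \<and>
           (\<exists>P \<in> \<PP>. \<exists>P' \<in> \<PP>. P \<noteq> P' \<and> \<gamma> ` I \<subseteq> P \<and> \<gamma> ` J \<subseteq> P'))}"

text \<open>The function \<open>s\<close> is the choice of an object in every pixel.\<close>

definition pixel_quiver ::
  "'a topology \<Rightarrow> 'a set set set \<Rightarrow> ('a set set \<Rightarrow> 'a set) \<Rightarrow>
     ('a set set,
      'a set set \<times> ((real \<Rightarrow> 'a set) set \<times> (real \<Rightarrow> 'a set) set) set \<times> 'a set set) pre_digraph" where
  "pixel_quiver X \<PP> s = \<lparr>
     verts = \<PP>,
     arcs = {(P, \<phi>, P') | P \<phi> P'. P \<in> \<PP> \<and> P' \<in> \<PP> \<and> \<phi> \<in> pseudo_arrows X \<PP> (s P) (s P')},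
     tail = (\<lambda>(P, \<phi>, P'). P),
     head = (\<lambda>(P, \<phi>, P'). P') \<rparr>"

definition pixel_Psi where
  "pixel_Psi X \<PP> s = free_extension (pixel_localization X \<PP>) s (\<lambda>(P, \<phi>, P'). \<phi>)"

definition pixelation where
  "pixelation X \<PP> s = quotient_cat (free_cat (pixel_quiver X \<PP> s)) (pixel_Psi X \<PP> s)"


section \<open>Spectra and localizations of rings\<close>

definition Spec :: "('a, 'b) ring_scheme \<Rightarrow> 'a set set" where
  "Spec R = {\<pp>. primeideal \<pp> R}"

definition zariski :: "('a, 'b) ring_scheme \<Rightarrow> 'a set topology" where
  "zariski R = topology (\<lambda>U. \<exists>E \<subseteq> carrier R. U = Spec R - {\<pp> \<in> Spec R. E \<subseteq> \<pp>})"

abbreviation TS :: "('a, 'b) ring_scheme \<Rightarrow> ('a set set, 'a set set \<times> 'a set set) cat" where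
  "TS R \<equiv> Top (zariski R)"

definition ring_fraction_rel :: "('a, 'b) ring_scheme \<Rightarrow> 'a set \<Rightarrow> (('a \<times> 'a) \<times> ('a \<times> 'a)) set" where
  "ring_fraction_rel R S =
     {((r, s), (r', s')). r \<in> carrier R \<and> s \<in> S \<and> r' \<in> carrier R \<and> s' \<in> S \<and>
        (\<exists>t \<in> S. t \<otimes>\<^bsub>R\<^esub> (r \<otimes>\<^bsub>R\<^esub> s' \<ominus>\<^bsub>R\<^esub> r' \<otimes>\<^bsub>R\<^esub> s) = \<zero>\<^bsub>R\<^esub>)}"

definition ring_fraction :: "('a, 'b) ring_scheme \<Rightarrow> 'a set \<Rightarrow> 'a \<Rightarrow> 'a \<Rightarrow> ('a \<times> 'a) set" where
  "ring_fraction R S r s = ring_fraction_rel R S `` {(r, s)}"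

text \<open>In sums and products the united classes all coincide.\<close>

definition ring_localization :: "('a, 'b) ring_scheme \<Rightarrow> 'a set \<Rightarrow> ('a \<times> 'a) set ring" where
  "ring_localization R S = \<lparr>
     carrier = (carrier R \<times> S) // ring_fraction_rel R S,
     monoid.mult = (\<lambda>x y. \<Union>{ring_fraction R S (r \<otimes>\<^bsub>R\<^esub> r') (s \<otimes>\<^bsub>R\<^esub> s') | r s r' s'.
        (r, s) \<in> x \<and> (r', s') \<in> y}),
     one = ring_fraction R S \<one>\<^bsub>R\<^esub> \<one>\<^bsub>R\<^esub>,
     zero = ring_fraction R S \<zero>\<^bsub>R\<^esub> \<one>\<^bsub>R\<^esub>,
     add = (\<lambda>x y. \<Union>{ring_fraction R S (r \<otimes>\<^bsub>R\<^esub> s' \<oplus>\<^bsub>R\<^esub> r' \<otimes>\<^bsub>R\<^esub> s) (s \<otimes>\<^bsub>R\<^esub> s') | r s r' s'.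
        (r, s) \<in> x \<and> (r', s') \<in> y}) \<rparr>"

text \<open>The map on spectra induced by \<open>r \<mapsto> r/1\<close>.\<close>

definition contraction :: "('a, 'b) ring_scheme \<Rightarrow> 'a set \<Rightarrow> ('a \<times> 'a) set set \<Rightarrow> 'a set" where
  "contraction R S \<qq> = {r \<in> carrier R. ring_fraction R S r \<one>\<^bsub>R\<^esub> \<in> \<qq>}"

definition prime_localization :: "('a, 'b) ring_scheme \<Rightarrow> 'a set \<Rightarrow> ('a \<times> 'a) set ring" where
  "prime_localization R \<pp> = ring_localization R (carrier R - \<pp>)"

end

theory Submission
  imports Defs "HOL-Algebra.QuotRing" "HOL-Algebra.Multiplicative_Group"
begin

text \<open>A fraction \<open>U \<rightarrow> V\<close> exists in the localization iff \<open>U \<inter> Y \<subseteq> V \<inter> Y\<close>: a middle object \<open>A\<close>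
  contains \<open>U\<close> and \<open>V\<close> and has the same trace on \<open>Y\<close> as \<open>V\<close>, and \<open>A = U \<union> V\<close> always works.
  Hence the localization is a preorder, there is a pseudo arrow exactly for a strict
  inclusion of traces, and the pixelation is the poset of traces, which is \<open>Top Y\<close>.
  For \<open>S\<^sup>-\<^sup>1R\<close> it remains to identify the spectrum with \<open>Y\<close> by contraction, a homeomorphism.\<close>

section \<open>Thin categories\<close>

text \<open>Every category compared here has at most one morphism between two objects, so no
  morphism map is ever computed: functoriality and the inverse laws follow from uniqueness, and only
  the question which hom-sets are empty carries content. The obstacle is that morphisms are concrete
  sets (classes of paths, of pairs of such classes, of walks) and that composites are unions over
  all representatives. Each of these equivalence relations turns out to be total on the
  representatives with given ends, so the one class is the whole set of them; naming it by its ends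
  turns every composite into a constant union. All three claims are instances of one theorem about a
  space homeomorphic to the subspace Y; the algebra only supplies the homeomorphism.\<close>

lemma thin_category:
  assumes "\<And>a b a' b' f. f \<in> Mor C a b \<Longrightarrow> f \<in> Mor C a' b' \<Longrightarrow> a = a' \<and> b = b'"
    and id: "\<And>a. a \<in> Ob C \<Longrightarrow> Ident C a \<in> Mor C a a"
    and comp: "\<And>a b c f g. \<lbrakk>a \<in> Ob C; b \<in> Ob C; c \<in> Ob C; f \<in> Mor C a b; g \<in> Mor C b c\<rbrakk>
       \<Longrightarrow> Comp C g f \<in> Mor C a c"
    and thin: "\<And>a b f g. \<lbrakk>a \<in> Ob C; b \<in> Ob C; f \<in> Mor C a b; g \<in> Mor C a b\<rbrakk> \<Longrightarrow> f = g"
  shows "category C"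
proof
  show "a = a' \<and> b = b'" if "f \<in> Mor C a b" "f \<in> Mor C a' b'" for a b a' b' f
    using assms(1) that by blast
  show "Comp C h (Comp C g f) = Comp C (Comp C h g) f"
    if "a \<in> Ob C" "b \<in> Ob C" "c \<in> Ob C" "d \<in> Ob C"
      "f \<in> Mor C a b" "g \<in> Mor C b c" "h \<in> Mor C c d" for a b c d f g h
    by (rule thin[of a d]) (use that in \<open>auto intro: comp\<close>)
qed (use id comp thin in \<open>blast+\<close>)

lemma thin_functor:
  assumes "category C" "category D"
    and F0: "\<And>a. a \<in> Ob C \<Longrightarrow> F0 a \<in> Ob D"
    and F1: "\<And>a b f. \<lbrakk>a \<in> Ob C; b \<in> Ob C; f \<in> Mor C a b\<rbrakk> \<Longrightarrow> F1 f \<in> Mor D (F0 a) (F0 b)"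
    and thin: "\<And>x y f g. \<lbrakk>x \<in> Ob D; y \<in> Ob D; f \<in> Mor D x y; g \<in> Mor D x y\<rbrakk> \<Longrightarrow> f = g"
  shows "cat_functor C D F0 F1"
proof -
  interpret C: category C by fact
  interpret D: category D by fact
  show ?thesis
  proof
    show "F1 (Ident C a) = Ident D (F0 a)" if "a \<in> Ob C" for a
      using thin[of "F0 a" "F0 a"] F0 F1 C.Ident_Mor D.Ident_Mor that by blast
    show "F1 (Comp C g f) = Comp D (F1 g) (F1 f)"
      if "a \<in> Ob C" "b \<in> Ob C" "c \<in> Ob C" "f \<in> Mor C a b" "g \<in> Mor C b c" for a b c f g
    proof (rule thin[of "F0 a" "F0 c"])
      show "F1 (Comp C g f) \<in> Mor D (F0 a) (F0 c)"
        using that F1 C.Comp_Mor by blast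
      show "Comp D (F1 g) (F1 f) \<in> Mor D (F0 a) (F0 c)"
        by (rule D.Comp_Mor[of _ "F0 b"]) (use that F0 F1 in auto)
    qed (use that F0 in auto)
  qed (use F0 F1 in auto)
qed

text \<open>A morphism map takes the bare morphism as argument, without its ends. Disjointness of
  hom-sets lets the ends be recovered from f, so a choice made from f alone lands in the right
  hom-set.\<close>

lemma thin_transport_morphisms:
  assumes "category C"
    and F0: "\<And>a. a \<in> Ob C \<Longrightarrow> F0 a \<in> Ob D"
    and hom: "\<And>a b. \<lbrakk>a \<in> Ob C; b \<in> Ob C; Mor C a b \<noteq> {}\<rbrakk> \<Longrightarrow> Mor D (F0 a) (F0 b) \<noteq> {}"
  obtains F1 where
    "\<And>a b f. \<lbrakk>a \<in> Ob C; b \<in> Ob C; f \<in> Mor C a b\<rbrakk> \<Longrightarrow> F1 f \<in> Mor D (F0 a) (F0 b)"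
proof
  let ?F1 = "\<lambda>f. SOME g. \<exists>a \<in> Ob C. \<exists>b \<in> Ob C. f \<in> Mor C a b \<and> g \<in> Mor D (F0 a) (F0 b)"
  fix a b f
  assume *: "a \<in> Ob C" "b \<in> Ob C" "f \<in> Mor C a b"
  then have "\<exists>g. \<exists>a \<in> Ob C. \<exists>b \<in> Ob C. f \<in> Mor C a b \<and> g \<in> Mor D (F0 a) (F0 b)"
    using hom[of a b] by blast
  from someI_ex[OF this] obtain a' b' where
    "a' \<in> Ob C" "b' \<in> Ob C" "f \<in> Mor C a' b'" "?F1 f \<in> Mor D (F0 a') (F0 b')" by blast
  moreover from this have "a' = a" "b' = b"
    using category.Mor_disjoint[OF assms(1), of a' b' a b f] * by auto
  ultimately show "?F1 f \<in> Mor D (F0 a) (F0 b)"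
    by simp
qed

text \<open>The morphism maps in both directions are chosen independently; uniqueness of morphisms
  makes them mutually inverse. For the same reason \<open>F1\<close> is determined on all morphisms,
  so quantifying it existentially loses nothing once \<open>F0\<close> is fixed.\<close>

lemma thin_isomorphism:
  assumes C: "category C" and D: "category D"
    and bij: "bij_betw F0 (Ob C) (Ob D)"
    and thinC: "\<And>a b f g. \<lbrakk>a \<in> Ob C; b \<in> Ob C; f \<in> Mor C a b; g \<in> Mor C a b\<rbrakk> \<Longrightarrow> f = g"
    and thinD: "\<And>x y f g. \<lbrakk>x \<in> Ob D; y \<in> Ob D; f \<in> Mor D x y; g \<in> Mor D x y\<rbrakk> \<Longrightarrow> f = g"
    and hom: "\<And>a b. \<lbrakk>a \<in> Ob C; b \<in> Ob C\<rbrakk> \<Longrightarrow> Mor C a b = {} \<longleftrightarrow> Mor D (F0 a) (F0 b) = {}"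
  shows "\<exists>F1. cat_isomorphism C D F0 F1"
proof -
  define G0 where "G0 = inv_into (Ob C) F0"
  have F0: "F0 a \<in> Ob D" if "a \<in> Ob C" for a
    using bij that by (auto simp: bij_betw_def)
  have G0: "G0 x \<in> Ob C" "F0 (G0 x) = x" if "x \<in> Ob D" for x
    using bij that unfolding G0_def by (auto simp: bij_betw_def intro: inv_into_into f_inv_into_f)
  have GF: "G0 (F0 a) = a" if "a \<in> Ob C" for a
    using bij that unfolding G0_def by (simp add: bij_betw_def)
  obtain F1 where F1: "\<And>a b f. \<lbrakk>a \<in> Ob C; b \<in> Ob C; f \<in> Mor C a b\<rbrakk> \<Longrightarrow> F1 f \<in> Mor D (F0 a) (F0 b)"
    by (rule thin_transport_morphisms[of C F0 D]) (use C F0 hom in auto)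
  obtain G1 where G1: "\<And>x y g. \<lbrakk>x \<in> Ob D; y \<in> Ob D; g \<in> Mor D x y\<rbrakk> \<Longrightarrow> G1 g \<in> Mor C (G0 x) (G0 y)"
    by (rule thin_transport_morphisms[of D G0 C]) (use D G0 hom in auto)
  have "cat_functor C D F0 F1"
    by (rule thin_functor) (use C D F0 F1 thinD in \<open>blast+\<close>)
  moreover have "cat_functor D C G0 G1"
    by (rule thin_functor) (use C D G0 G1 thinC in \<open>blast+\<close>)
  moreover have "G1 (F1 f) = f" if "a \<in> Ob C" "b \<in> Ob C" "f \<in> Mor C a b" for a b f
    using G1[OF F0 F0 F1] GF thinC that by metis
  moreover have "F1 (G1 g) = g" if "x \<in> Ob D" "y \<in> Ob D" "g \<in> Mor D x y" for x y g
    using F1[OF G0(1) G0(1) G1] G0 thinD that by metis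
  ultimately show ?thesis
    unfolding cat_isomorphism_def using GF G0(2) by blast
qed

lemma category_Top: "category (Top X)"
  by (rule thin_category) (auto simp: Top_def)

text \<open>Composites in \<open>localize\<close> and \<open>quotient_cat\<close>, and the
  operations of \<open>ring_localization\<close>, are unions of classes over all representatives.
  Equality of the members is not enough to evaluate them: an empty family would give the empty set,
  hence the witness y.\<close>

lemma Union_constant:
  assumes "\<And>x. x \<in> A \<Longrightarrow> x = c" "y \<in> A"
  shows "\<Union>A = c"
  using assms by blast

section \<open>The path presentation of open sets\<close>

text \<open>The class of a path depends on its ends only. This form names the class without a
  representative and makes sense even when no path exists.\<close>

definition paths_between :: "'a topology \<Rightarrow> 'a set \<Rightarrow> 'a set \<Rightarrow> (real \<Rightarrow> 'a set) set" where
  "paths_between X U V = {\<gamma> \<in> open_paths X. \<gamma> 0 = U \<and> \<gamma> 1 = V}"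

text \<open>The simplest path with the required ends: a single jump, hence n = 1, and U = V is
  allowed. The same jump later splits the unit interval for pseudo arrows.\<close>

definition step_path :: "'a set \<Rightarrow> 'a set \<Rightarrow> real \<Rightarrow> 'a set" where
  "step_path U V = restrict (\<lambda>t. if t \<le> 1/2 then U else V) {0..1}"

lemma path_class_eq: "path_class X \<gamma> = paths_between X (\<gamma> 0) (\<gamma> 1)"
  by (simp add: path_class_def paths_between_def)

lemma open_pathE:
  assumes "\<gamma> \<in> open_paths X"
  obtains n and I :: "nat \<Rightarrow> real set" and U where
    "(\<Union>i \<le> n. I i) = {0..1}"
    "\<forall>i j. i < j \<and> j \<le> n \<longrightarrow> (\<forall>x \<in> I i. \<forall>y \<in> I j. x < y)"
    "\<forall>i \<le> n. openin X (U i)"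
    "\<forall>i < n. U i \<subseteq> U (Suc i)"
    "\<forall>i \<le> n. \<forall>t \<in> I i. \<gamma> t = U i"
  using assms unfolding open_paths_def mem_Collect_eq by (elim exE conjE) (rule that)

lemma open_path_openin:
  assumes "\<gamma> \<in> open_paths X" "t \<in> {0..1}"
  shows "openin X (\<gamma> t)"
proof -
  obtain n and I :: "nat \<Rightarrow> real set" and U where
    cover: "(\<Union>i \<le> n. I i) = {0..1}" and U: "\<forall>i \<le> n. openin X (U i)"
    and \<gamma>: "\<forall>i \<le> n. \<forall>t \<in> I i. \<gamma> t = U i"
    using assms(1) by (elim open_pathE)
  have "t \<in> (\<Union>i \<le> n. I i)"
    using assms(2) cover by simp
  then obtain i where "i \<le> n" "t \<in> I i"
    by blast
  then show ?thesis
    using U \<gamma> by simp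
qed

lemma open_path_mono:
  assumes "\<gamma> \<in> open_paths X" "t \<in> {0..1}" "t' \<in> {0..1}" "t \<le> t'"
  shows "\<gamma> t \<subseteq> \<gamma> t'"
proof -
  obtain n and I :: "nat \<Rightarrow> real set" and U where
    cover: "(\<Union>i \<le> n. I i) = {0..1}"
    and less: "\<forall>i j. i < j \<and> j \<le> n \<longrightarrow> (\<forall>x \<in> I i. \<forall>y \<in> I j. x < y)"
    and U: "\<forall>i < n. U i \<subseteq> U (Suc i)"
    and \<gamma>: "\<forall>i \<le> n. \<forall>t \<in> I i. \<gamma> t = U i"
    using assms(1) by (elim open_pathE)
  have "t \<in> (\<Union>i \<le> n. I i)" "t' \<in> (\<Union>i \<le> n. I i)"
    using assms(2,3) cover by simp_all
  then obtain i j where ij: "i \<le> n" "t \<in> I i" "j \<le> n" "t' \<in> I j"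
    by blast
  have "i \<le> j"
    using less ij assms(4) by (meson leI not_less)
  then have "j \<le> n \<Longrightarrow> U i \<subseteq> U j"
    by (induction j rule: dec_induct) (use U in \<open>auto simp: less_eq_Suc_le\<close>)
  then show ?thesis
    using \<gamma> ij by simp
qed

lemma step_path_simps [simp]: "step_path U V 0 = U" "step_path U V 1 = V"
  by (simp_all add: step_path_def)

lemma step_path_open:
  assumes "openin X U" "openin X V" "U \<subseteq> V"
  shows "step_path U V \<in> open_paths X"
  unfolding open_paths_def
proof (intro CollectI conjI exI[of _ "1::nat"]
    exI[of _ "\<lambda>i::nat. if i = 0 then {0..1/2} else {1/2<..1::real}"]
    exI[of _ "\<lambda>i::nat. if i = 0 then U else V"])
  show "(\<Union>i\<le>1::nat. if i = 0 then {0..1/2} else {1/2<..1::real}) = {0..1}"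
    by (auto simp: atMost_Suc)
qed (use assms in \<open>auto simp: step_path_def is_interval_cc is_interval_oc\<close>)

lemma step_path_in_paths_between:
  assumes "openin X U" "openin X V" "U \<subseteq> V"
  shows "step_path U V \<in> paths_between X U V"
  using step_path_open[OF assms] by (simp add: paths_between_def)

lemma paths_between_eq_empty_iff:
  "paths_between X U V = {} \<longleftrightarrow> \<not> (openin X U \<and> openin X V \<and> U \<subseteq> V)"
proof
  show "\<not> (openin X U \<and> openin X V \<and> U \<subseteq> V)" if "paths_between X U V = {}"
    using that step_path_in_paths_between[of X U V] by blast
  have "openin X U \<and> openin X V \<and> U \<subseteq> V" if "\<gamma> \<in> paths_between X U V" for \<gamma>
    using that open_path_openin[of \<gamma> X 0] open_path_openin[of \<gamma> X 1] open_path_mono[of \<gamma> X 0 1]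
    by (simp add: paths_between_def)
  then show "paths_between X U V = {}" if "\<not> (openin X U \<and> openin X V \<and> U \<subseteq> V)"
    using that by blast
qed

text \<open>The ends of \<open>step_path\<close> can be read off in any class that contains it. This
  recovers source and target inside \<open>localize\<close>, whose composite quantifies over the
  objects afresh.\<close>

lemma paths_between_inj:
  assumes "paths_between X U V = paths_between X U' V'" "openin X U" "openin X V" "U \<subseteq> V"
  shows "U = U' \<and> V = V'"
proof -
  have "step_path U V \<in> paths_between X U' V'"
    using step_path_in_paths_between[OF assms(2-4)] assms(1) by simp
  then show ?thesis
    by (simp add: paths_between_def)
qed

lemma Mor_path_cat_iff:
  "f \<in> Mor (path_cat X) U V \<longleftrightarrow> f = paths_between X U V \<and> openin X U \<and> openin X V \<and> U \<subseteq> V"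
proof -
  have "f \<in> Mor (path_cat X) U V \<longleftrightarrow> f = paths_between X U V \<and> paths_between X U V \<noteq> {}"
    by (auto simp: path_cat_def path_class_eq) (auto simp: paths_between_def)
  then show ?thesis
    using paths_between_eq_empty_iff[of X U V] by blast
qed

lemma Comp_path_cat:
  assumes "openin X U" "openin X V" "openin X W" "U \<subseteq> V" "V \<subseteq> W"
  shows "Comp (path_cat X) (paths_between X V W) (paths_between X U V) = paths_between X U W"
proof -
  have *: "path_concat \<gamma> \<delta> 0 = \<gamma> 0" "path_concat \<gamma> \<delta> 1 = \<delta> 1" for \<gamma> \<delta> :: "real \<Rightarrow> 'a set"
    by (simp_all add: path_concat_def)
  have cls: "path_class X (path_concat \<gamma> \<delta>) = paths_between X U W"
    if "\<gamma> \<in> paths_between X U V" "\<delta> \<in> paths_between X V W" for \<gamma> \<delta>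
    using that by (simp add: path_class_eq * paths_between_def)
  have steps: "step_path U V \<in> paths_between X U V" "step_path V W \<in> paths_between X V W"
    using assms by (auto intro: step_path_in_paths_between)
  have "{path_class X (path_concat \<gamma> \<delta>) | \<gamma> \<delta>.
      \<gamma> \<in> paths_between X U V \<and> \<delta> \<in> paths_between X V W \<and> \<gamma> 1 = \<delta> 0} = {paths_between X U W}"
  proof (intro equalityI subsetI)
    fix x assume "x \<in> {paths_between X U W}"
    then have "x = path_class X (path_concat (step_path U V) (step_path V W))"
      using cls steps by simp
    moreover have "step_path U V 1 = step_path V W 0"
      by simp
    ultimately show "x \<in> {path_class X (path_concat \<gamma> \<delta>) | \<gamma> \<delta>.
      \<gamma> \<in> paths_between X U V \<and> \<delta> \<in> paths_between X V W \<and> \<gamma> 1 = \<delta> 0}"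
      using steps by blast
  qed (auto simp: cls)
  then show ?thesis
    by (simp add: path_cat_def)
qed

lemma Ob_path_cat: "Ob (path_cat X) = {U. openin X U}"
  by (simp add: path_cat_def)

section \<open>Localization at a pixel partition\<close>

text \<open>A representative inside one pixel forces both ends to have the same trace. Conversely
  \<open>step_path\<close> has no values besides U and V, so equal traces keep it inside one
  pixel.\<close>

lemma paths_between_pixel_map_iff:
  assumes "openin X U" "openin X V" "U \<subseteq> V"
  shows "paths_between X U V \<in> pixel_maps X (pixels X Y) \<longleftrightarrow> U \<inter> Y = V \<inter> Y"
proof
  assume "paths_between X U V \<in> pixel_maps X (pixels X Y)"
  then obtain \<rho> where \<rho>: "paths_between X U V = path_class X \<rho>"
    and "\<exists>P \<in> pixels X Y. \<rho> ` {0..1} \<subseteq> P"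
    unfolding pixel_maps_def by blast
  then obtain P where P: "P \<in> pixels X Y" "\<rho> ` {0..1} \<subseteq> P"
    by blast
  have "U = \<rho> 0 \<and> V = \<rho> 1"
    using paths_between_inj[OF \<rho>[unfolded path_class_eq] assms] .
  moreover have "\<rho> 0 \<in> P" "\<rho> 1 \<in> P"
    using P(2) by auto
  ultimately show "U \<inter> Y = V \<inter> Y"
    using P(1) by (auto simp: pixels_def pixel_def)
next
  assume eq: "U \<inter> Y = V \<inter> Y"
  then have "step_path U V ` {0..1} \<subseteq> pixel X Y (U \<inter> Y)"
    using assms by (auto simp: step_path_def pixel_def)
  moreover have "pixel X Y (U \<inter> Y) \<in> pixels X Y"
    using assms(1) by (auto simp: pixels_def pixel_def)
  moreover have "paths_between X U V = path_class X (step_path U V)"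
    by (simp add: path_class_eq)
  ultimately show "paths_between X U V \<in> pixel_maps X (pixels X Y)"
    unfolding pixel_maps_def using step_path_open[OF assms] by blast
qed

abbreviation pixel_fractions where
  "pixel_fractions X Y U V \<equiv> left_fractions (path_cat X) (pixel_maps X (pixels X Y)) U V"

lemma pixel_fractions_iff:
  "(f, g) \<in> pixel_fractions X Y U V \<longleftrightarrow>
     (\<exists>A. openin X A \<and> openin X U \<and> openin X V \<and> U \<subseteq> A \<and> V \<subseteq> A \<and> V \<inter> Y = A \<inter> Y \<and>
        f = paths_between X U A \<and> g = paths_between X V A)"
  by (auto simp: left_fractions_def Ob_path_cat Mor_path_cat_iff paths_between_pixel_map_iff)

lemma pixel_fractions_eq_empty_iff:
  assumes "openin X U" "openin X V"
  shows "pixel_fractions X Y U V = {} \<longleftrightarrow> \<not> U \<inter> Y \<subseteq> V \<inter> Y"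
proof
  show "\<not> U \<inter> Y \<subseteq> V \<inter> Y" if "pixel_fractions X Y U V = {}"
  proof
    assume "U \<inter> Y \<subseteq> V \<inter> Y"
    then have "(paths_between X U (U \<union> V), paths_between X V (U \<union> V)) \<in> pixel_fractions X Y U V"
      unfolding pixel_fractions_iff using assms by blast
    with that show False by blast
  qed
  show "pixel_fractions X Y U V = {}" if "\<not> U \<inter> Y \<subseteq> V \<inter> Y"
    using that by (fastforce simp: pixel_fractions_iff)
qed

text \<open>Two fractions with common source and target are always identified, in the union of their
  middle objects.\<close>

lemma pixel_fraction_rel:
  "fraction_rel (path_cat X) (pixel_maps X (pixels X Y)) U V =
     pixel_fractions X Y U V \<times> pixel_fractions X Y U V"
proof -
  have "((f, g), (f', g')) \<in> fraction_rel (path_cat X) (pixel_maps X (pixels X Y)) U V"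
    if fg: "(f, g) \<in> pixel_fractions X Y U V" "(f', g') \<in> pixel_fractions X Y U V" for f g f' g'
  proof -
    obtain A A' where A: "openin X A" "openin X U" "openin X V" "U \<subseteq> A" "V \<subseteq> A" "V \<inter> Y = A \<inter> Y"
      "f = paths_between X U A" "g = paths_between X V A"
      and A': "openin X A'" "U \<subseteq> A'" "V \<subseteq> A'" "V \<inter> Y = A' \<inter> Y"
      "f' = paths_between X U A'" "g' = paths_between X V A'"
      using fg unfolding pixel_fractions_iff by blast
    let ?B = "A \<union> A'"
    have B: "openin X ?B" "A \<subseteq> ?B" "A' \<subseteq> ?B" "V \<subseteq> ?B" "U \<subseteq> ?B" "V \<inter> Y = ?B \<inter> Y"
      using A A' by auto
    have "A \<in> Ob (path_cat X)" "A' \<in> Ob (path_cat X)" "?B \<in> Ob (path_cat X)"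
      using A A' B by (auto simp: Ob_path_cat)
    moreover have "paths_between X A ?B \<in> Mor (path_cat X) A ?B"
      "paths_between X A' ?B \<in> Mor (path_cat X) A' ?B"
      "f \<in> Mor (path_cat X) U A" "g \<in> Mor (path_cat X) V A"
      "f' \<in> Mor (path_cat X) U A'" "g' \<in> Mor (path_cat X) V A'"
      using A A' B by (auto simp: Mor_path_cat_iff)
    moreover have "Comp (path_cat X) (paths_between X A ?B) f = paths_between X U ?B"
      "Comp (path_cat X) (paths_between X A' ?B) f' = paths_between X U ?B"
      "Comp (path_cat X) (paths_between X A ?B) g = paths_between X V ?B"
      "Comp (path_cat X) (paths_between X A' ?B) g' = paths_between X V ?B"
      using A A' B by (simp_all add: Comp_path_cat)
    moreover have "paths_between X V ?B \<in> pixel_maps X (pixels X Y)"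
      using A(3) B by (subst paths_between_pixel_map_iff) auto
    ultimately show ?thesis
      unfolding fraction_rel_def using fg by simp metis
  qed
  moreover have "fraction_rel (path_cat X) (pixel_maps X (pixels X Y)) U V \<subseteq>
     pixel_fractions X Y U V \<times> pixel_fractions X Y U V"
    by (auto simp: fraction_rel_def)
  ultimately show ?thesis
    by (auto 0 3)
qed

text \<open>As the relation is total, the class of any fraction is the set of all fractions. A
  morphism of the localization is therefore literally
  \<open>pixel_fractions X Y U V\<close>.\<close>

lemma pixel_fraction_eq:
  assumes "(f, g) \<in> pixel_fractions X Y U V"
  shows "fraction (path_cat X) (pixel_maps X (pixels X Y)) U V f g = pixel_fractions X Y U V"
  using assms by (auto simp: fraction_def pixel_fraction_rel)

lemma Ident_pixel_localization:
  assumes "openin X U"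
  shows "Ident (pixel_localization X (pixels X Y)) U = pixel_fractions X Y U U"
proof -
  have "Ident (path_cat X) U = paths_between X U U"
    by (simp add: path_cat_def path_class_eq)
  then have "(Ident (path_cat X) U, Ident (path_cat X) U) \<in> pixel_fractions X Y U U"
    using assms by (auto simp: pixel_fractions_iff)
  then show ?thesis
    by (simp add: localize_def pixel_fraction_eq)
qed

text \<open>The union in \<open>localize\<close> runs over every completion of every pair of
  representatives. Any apex P has the trace of Z, so each member is the class from U to Z; one
  explicit completion shows that the family is inhabited.\<close>

lemma Comp_pixel_localization:
  assumes U: "openin X U" and V: "openin X V" and Z: "openin X Z"
    and UV: "U \<inter> Y \<subseteq> V \<inter> Y" and VZ: "V \<inter> Y \<subseteq> Z \<inter> Y"
  shows "Comp (pixel_localization X (pixels X Y)) (pixel_fractions X Y V Z) (pixel_fractions X Y U V) =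
    pixel_fractions X Y U Z"
proof -
  let ?C = "path_cat X" and ?W = "pixel_maps X (pixels X Y)"
  let ?S = "{fraction ?C ?W U' Z' (Comp ?C h f) (Comp ?C u t) | U' V' Z' A B P f s g t h u.
        {U', V', Z', A, B, P} \<subseteq> Ob ?C \<and>
        (f, s) \<in> pixel_fractions X Y U V \<and> f \<in> Mor ?C U' A \<and> s \<in> Mor ?C V' A \<and>
        (g, t) \<in> pixel_fractions X Y V Z \<and> g \<in> Mor ?C V' B \<and> t \<in> Mor ?C Z' B \<and>
        h \<in> Mor ?C A P \<and> u \<in> Mor ?C B P \<and> u \<in> ?W \<and> Comp ?C h s = Comp ?C u g}"
  have const: "x = pixel_fractions X Y U Z" if x: "x \<in> ?S" for x
  proof -
    obtain U' V' Z' A B P f s g t h u where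
      x: "x = fraction ?C ?W U' Z' (Comp ?C h f) (Comp ?C u t)"
      and fs: "(f, s) \<in> pixel_fractions X Y U V" and f: "f \<in> Mor ?C U' A" and s: "s \<in> Mor ?C V' A"
      and gt: "(g, t) \<in> pixel_fractions X Y V Z" and g: "g \<in> Mor ?C V' B" and t: "t \<in> Mor ?C Z' B"
      and h: "h \<in> Mor ?C A P" and u: "u \<in> Mor ?C B P" and W: "u \<in> ?W"
      using x unfolding mem_Collect_eq by (elim exE conjE) (rule that)
    obtain A0 where "f = paths_between X U A0" "openin X A0" "U \<subseteq> A0"
      using fs unfolding pixel_fractions_iff by blast
    then have U': "U' = U"
      using f U paths_between_inj[of X U A0 U' A] unfolding Mor_path_cat_iff by blast
    obtain B0 where B0: "t = paths_between X Z B0" "openin X B0" "Z \<subseteq> B0" "Z \<inter> Y = B0 \<inter> Y"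
      using gt unfolding pixel_fractions_iff by blast
    then have Z': "Z' = Z" "B = B0"
      using t Z paths_between_inj[of X Z B0 Z' B] unfolding Mor_path_cat_iff by blast+
    have sub: "openin X A" "openin X B" "openin X P" "U \<subseteq> A" "A \<subseteq> P" "Z \<subseteq> B" "B \<subseteq> P"
      using f h t u unfolding Mor_path_cat_iff U' Z'(1) by simp_all
    have "Comp ?C h f = paths_between X U P" "Comp ?C u t = paths_between X Z P"
      using Comp_path_cat[of X U A P] Comp_path_cat[of X Z B P] U Z sub f h t u
      unfolding Mor_path_cat_iff U' Z'(1) by simp_all
    \<comment> \<open>Both \<open>t\<close>, from Z to B, and \<open>u\<close>, from B to P,
      preserve the trace, so P may serve as middle object of a fraction from U to Z.\<close>
    moreover have "B \<inter> Y = P \<inter> Y"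
      using u W paths_between_pixel_map_iff[OF sub(2,3,7), of Y] unfolding Mor_path_cat_iff by simp
    then have "(paths_between X U P, paths_between X Z P) \<in> pixel_fractions X Y U Z"
      unfolding pixel_fractions_iff
      using U Z sub B0(4) Z'(2) by (intro exI[of _ P]) auto
    ultimately show ?thesis
      unfolding x U' Z'(1) by (simp add: pixel_fraction_eq)
  qed
  \<comment> \<open>The smallest completion. Passing from V \<union> Z to U \<union> V \<union> Z
    adds nothing to the trace, since U meets Y inside V; that leg is therefore a pixel map.\<close>
  let ?A = "U \<union> V" and ?B = "V \<union> Z" and ?P = "U \<union> V \<union> Z"
  have op: "openin X ?A" "openin X ?B" "openin X ?P"
    using U V Z by auto
  have fractions: "(paths_between X U ?A, paths_between X V ?A) \<in> pixel_fractions X Y U V"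
    "(paths_between X V ?B, paths_between X Z ?B) \<in> pixel_fractions X Y V Z"
    unfolding pixel_fractions_iff using U V Z UV VZ op by blast+
  have W: "paths_between X ?B ?P \<in> ?W"
    using U V Z UV VZ op by (subst paths_between_pixel_map_iff) auto
  have square: "Comp ?C (paths_between X ?A ?P) (paths_between X V ?A) =
      Comp ?C (paths_between X ?B ?P) (paths_between X V ?B)"
    using Comp_path_cat[of X V ?A ?P] Comp_path_cat[of X V ?B ?P] V op by fastforce
  have Mor: "paths_between X U ?A \<in> Mor ?C U ?A" "paths_between X V ?A \<in> Mor ?C V ?A"
    "paths_between X V ?B \<in> Mor ?C V ?B" "paths_between X Z ?B \<in> Mor ?C Z ?B"
    "paths_between X ?A ?P \<in> Mor ?C ?A ?P" "paths_between X ?B ?P \<in> Mor ?C ?B ?P"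
    "{U, V, Z, ?A, ?B, ?P} \<subseteq> Ob ?C"
    using U V Z op by (auto simp: Mor_path_cat_iff Ob_path_cat)
  have "fraction ?C ?W U Z (Comp ?C (paths_between X ?A ?P) (paths_between X U ?A))
      (Comp ?C (paths_between X ?B ?P) (paths_between X Z ?B)) \<in> ?S"
    unfolding mem_Collect_eq
    by (rule exI[of _ U], rule exI[of _ V], rule exI[of _ Z], rule exI[of _ ?A], rule exI[of _ ?B],
        rule exI[of _ ?P], rule exI[of _ "paths_between X U ?A"], rule exI[of _ "paths_between X V ?A"],
        rule exI[of _ "paths_between X V ?B"], rule exI[of _ "paths_between X Z ?B"],
        rule exI[of _ "paths_between X ?A ?P"], rule exI[of _ "paths_between X ?B ?P"])
      (rule conjI refl fractions W square Mor)+
  with const have "\<Union>?S = pixel_fractions X Y U Z"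
    by (rule Union_constant)
  then show ?thesis
    by (simp add: localize_def)
qed

section \<open>The pixelation as a thin category\<close>

lemma cas_append:
  assumes "pre_digraph.cas G u p v" "pre_digraph.cas G v q w"
  shows "pre_digraph.cas G u (p @ q) w"
  using assms by (induction p arbitrary: u) (auto simp: pre_digraph.cas.simps)

context
  fixes X :: "'a topology" and Y :: "'a set" and s :: "'a set set \<Rightarrow> 'a set"
  assumes s: "\<forall>P \<in> pixels X Y. s P \<in> P"
begin

text \<open>The equation puts an open \<open>s P\<close> into P, so P is nonempty. It also recovers
  P from the trace of its chosen object, the source of \<open>pixel_eq_iff\<close> and of the
  inverse in \<open>bij_betw_pixel\<close>.\<close>

lemma pixels_iff: "P \<in> pixels X Y \<longleftrightarrow> openin X (s P) \<and> P = pixel X Y (s P \<inter> Y)"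
proof
  assume "P \<in> pixels X Y"
  moreover from this have "s P \<in> P"
    using s by blast
  ultimately show "openin X (s P) \<and> P = pixel X Y (s P \<inter> Y)"
    by (auto simp: pixels_def pixel_def)
next
  assume P: "openin X (s P) \<and> P = pixel X Y (s P \<inter> Y)"
  then have "s P \<in> pixel X Y (s P \<inter> Y)"
    unfolding pixel_def by blast
  with P show "P \<in> pixels X Y"
    unfolding pixels_def by blast
qed

text \<open>All members of a pixel share one trace, so the trace of the chosen object is independent
  of the choice \<open>s\<close>.\<close>

lemma choice_pixel_Int:
  assumes "openin X U"
  shows "pixel X Y (U \<inter> Y) \<in> pixels X Y" "s (pixel X Y (U \<inter> Y)) \<inter> Y = U \<inter> Y"
proof -
  show *: "pixel X Y (U \<inter> Y) \<in> pixels X Y"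
    using assms by (auto simp: pixels_def pixel_def)
  then have "s (pixel X Y (U \<inter> Y)) \<in> pixel X Y (U \<inter> Y)"
    using s by blast
  then show "s (pixel X Y (U \<inter> Y)) \<inter> Y = U \<inter> Y"
    by (simp add: pixel_def)
qed

lemma pixel_eq_iff:
  assumes "P \<in> pixels X Y" "Q \<in> pixels X Y"
  shows "P = Q \<longleftrightarrow> s P \<inter> Y = s Q \<inter> Y"
  using assms pixels_iff by metis

text \<open>The common endpoint \<open>\<rho> 1\<close> is the middle object of a fraction from U to
  V, and such fractions form a single class. Hence there is at most one pseudo arrow between two
  chosen objects.\<close>

lemma pseudo_arrow_eq:
  assumes "openin X U" "openin X V" "\<phi> \<in> pseudo_arrows X (pixels X Y) U V"
  shows "\<phi> = pixel_fractions X Y U V \<and> U \<inter> Y \<subseteq> V \<inter> Y"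
proof -
  obtain \<gamma> \<rho> where
    \<phi>: "\<phi> = fraction (path_cat X) (pixel_maps X (pixels X Y)) U V (path_class X \<gamma>) (path_class X \<rho>)"
    and \<gamma>\<rho>: "\<gamma> \<in> open_paths X" "\<rho> \<in> open_paths X" "\<gamma> 0 = U" "\<rho> 0 = V" "\<gamma> 1 = \<rho> 1"
    and W: "path_class X \<rho> \<in> pixel_maps X (pixels X Y)"
    using assms(3) unfolding pseudo_arrows_def mem_Collect_eq by (elim exE conjE) (rule that)
  have "openin X (\<rho> 1)" "U \<subseteq> \<rho> 1" "V \<subseteq> \<rho> 1"
    using \<gamma>\<rho> open_path_openin[of \<rho> X 1] open_path_mono[of \<rho> X 0 1] open_path_mono[of \<gamma> X 0 1] by auto
  moreover from this have "V \<inter> Y = \<rho> 1 \<inter> Y"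
    using W assms \<gamma>\<rho> paths_between_pixel_map_iff[of X V "\<rho> 1" Y] by (simp add: path_class_eq)
  ultimately have "(path_class X \<gamma>, path_class X \<rho>) \<in> pixel_fractions X Y U V"
    unfolding pixel_fractions_iff path_class_eq using assms \<gamma>\<rho> by metis
  moreover from this have "U \<inter> Y \<subseteq> V \<inter> Y"
    using pixel_fractions_eq_empty_iff[OF assms(1,2), of Y] by blast
  ultimately show ?thesis
    using \<phi> by (simp add: pixel_fraction_eq)
qed

text \<open>Only the traces are nested, not U and V themselves, so \<gamma> jumps from U to U
  \<union> V. The union has the trace of V, so \<rho> stays in one pixel; strictness makes the two
  pixels met by \<gamma> distinct.\<close>

lemma pseudo_arrow_exists:
  assumes "openin X U" "openin X V" "U \<inter> Y \<subset> V \<inter> Y"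
  shows "pseudo_arrows X (pixels X Y) U V \<noteq> {}"
proof -
  let ?\<gamma> = "step_path U (U \<union> V)" and ?\<rho> = "step_path V (U \<union> V)"
  have "?\<gamma> \<in> open_paths X" "?\<rho> \<in> open_paths X" "?\<gamma> 0 = U" "?\<rho> 0 = V" "?\<gamma> 1 = ?\<rho> 1"
    using assms by (auto intro: step_path_open)
  moreover have "path_class X ?\<rho> \<in> pixel_maps X (pixels X Y)"
    using assms paths_between_pixel_map_iff[of X V "U \<union> V" Y] by (auto simp: path_class_eq)
  moreover have "is_interval {0..1/2::real}" "is_interval {1/2<..1::real}" "{0..1/2::real} \<noteq> {}"
    "{1/2<..1::real} \<noteq> {}" "{0..1/2} \<inter> {1/2<..1::real} = {}" "{0..1/2} \<union> {1/2<..1::real} = {0..1}"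
    by (auto simp: is_interval_cc is_interval_oc)
  moreover have "pixel X Y (U \<inter> Y) \<in> pixels X Y" "pixel X Y (V \<inter> Y) \<in> pixels X Y"
    using assms choice_pixel_Int by auto
  moreover have "pixel X Y (U \<inter> Y) \<noteq> pixel X Y (V \<inter> Y)"
    using assms by (auto simp: pixel_def)
  moreover have "?\<gamma> ` {0..1/2} \<subseteq> pixel X Y (U \<inter> Y)"
    using assms by (auto simp: pixel_def step_path_def)
  moreover have "?\<gamma> ` {1/2<..1} \<subseteq> pixel X Y (V \<inter> Y)"
    using assms by (auto simp: pixel_def step_path_def)
  ultimately have "fraction (path_cat X) (pixel_maps X (pixels X Y)) U V (path_class X ?\<gamma>) (path_class X ?\<rho>)
      \<in> pseudo_arrows X (pixels X Y) U V"
    unfolding pseudo_arrows_def by blast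
  then show ?thesis
    by blast
qed

section \<open>Walks in the pixel quiver and their values in the localization\<close>

abbreviation quiver where
  "quiver \<equiv> pixel_quiver X (pixels X Y) s"

text \<open>The induction needs a source \<open>P0\<close> that stays fixed while the current vertex
  moves, since \<open>foldl\<close> accumulates the morphism reached so far. Nested traces belong to
  the invariant because \<open>Comp_pixel_localization\<close> asks for them.\<close>

lemma pixel_quiver_walk_value:
  assumes "pre_digraph.cas quiver P p Q" "set p \<subseteq> arcs quiver"
    and "P0 \<in> pixels X Y" "P \<in> pixels X Y" "s P0 \<inter> Y \<subseteq> s P \<inter> Y"
  shows "foldl (\<lambda>m e. Comp (pixel_localization X (pixels X Y)) ((\<lambda>(P, \<phi>, P'). \<phi>) e) m)
      (pixel_fractions X Y (s P0) (s P)) p = pixel_fractions X Y (s P0) (s Q) \<and> s P0 \<inter> Y \<subseteq> s Q \<inter> Y"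
  using assms
proof (induction p arbitrary: P)
  case Nil
  then show ?case
    by (simp add: pre_digraph.cas.simps)
next
  case (Cons e p)
  obtain \<phi> P' where e: "e = (P, \<phi>, P')" "P' \<in> pixels X Y" "\<phi> \<in> pseudo_arrows X (pixels X Y) (s P) (s P')"
    and cas: "pre_digraph.cas quiver P' p Q"
    using Cons.prems(1,2) by (auto simp: pre_digraph.cas.simps pixel_quiver_def)
  have op: "openin X (s P0)" "openin X (s P)" "openin X (s P')"
    using Cons.prems(3,4) e(2) pixels_iff by blast+
  then have \<phi>: "\<phi> = pixel_fractions X Y (s P) (s P')" "s P \<inter> Y \<subseteq> s P' \<inter> Y"
    using pseudo_arrow_eq e(3) by blast+
  have "Comp (pixel_localization X (pixels X Y)) \<phi> (pixel_fractions X Y (s P0) (s P)) =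
      pixel_fractions X Y (s P0) (s P')"
    unfolding \<phi>(1) by (rule Comp_pixel_localization) (use op \<phi> Cons.prems(5) in auto)
  moreover have "s P0 \<inter> Y \<subseteq> s P' \<inter> Y"
    using \<phi>(2) Cons.prems(5) by blast
  ultimately show ?case
    using Cons.IH[OF cas _ Cons.prems(3) e(2)] Cons.prems(2) e(1) by simp
qed

lemma awalk_value:
  assumes "pre_digraph.awalk quiver P p Q"
  shows "pixel_Psi X (pixels X Y) s (P, p, Q) = pixel_fractions X Y (s P) (s Q)"
    and "s P \<inter> Y \<subseteq> s Q \<inter> Y"
proof -
  have P: "P \<in> pixels X Y" and "pre_digraph.cas quiver P p Q" "set p \<subseteq> arcs quiver"
    using assms by (auto simp: pre_digraph.awalk_def pixel_quiver_def)
  then have "foldl (\<lambda>m e. Comp (pixel_localization X (pixels X Y)) ((\<lambda>(P, \<phi>, P'). \<phi>) e) m)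
      (pixel_fractions X Y (s P) (s P)) p = pixel_fractions X Y (s P) (s Q) \<and> s P \<inter> Y \<subseteq> s Q \<inter> Y"
    by (intro pixel_quiver_walk_value) auto
  moreover have "openin X (s P)"
    using P pixels_iff by blast
  ultimately show "pixel_Psi X (pixels X Y) s (P, p, Q) = pixel_fractions X Y (s P) (s Q)"
    "s P \<inter> Y \<subseteq> s Q \<inter> Y"
    by (simp_all add: pixel_Psi_def free_extension_def Ident_pixel_localization)
qed

text \<open>Walks of length at most one suffice: the empty one if P = Q, and otherwise a single
  arrow, because distinct pixels have distinct traces and the inclusion is then strict.\<close>

lemma awalk_exists_iff:
  assumes "P \<in> pixels X Y" "Q \<in> pixels X Y"
  shows "(\<exists>p. pre_digraph.awalk quiver P p Q) \<longleftrightarrow> s P \<inter> Y \<subseteq> s Q \<inter> Y"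
proof
  show "s P \<inter> Y \<subseteq> s Q \<inter> Y" if "\<exists>p. pre_digraph.awalk quiver P p Q"
    using that awalk_value(2) by blast
  assume sub: "s P \<inter> Y \<subseteq> s Q \<inter> Y"
  show "\<exists>p. pre_digraph.awalk quiver P p Q"
  proof (cases "P = Q")
    case True
    then have "pre_digraph.awalk quiver P [] Q"
      using assms by (simp add: pre_digraph.awalk_def pre_digraph.cas.simps pixel_quiver_def)
    then show ?thesis ..
  next
    case False
    then have "s P \<inter> Y \<subset> s Q \<inter> Y"
      using sub pixel_eq_iff[OF assms] by blast
    moreover have "openin X (s P)" "openin X (s Q)"
      using assms pixels_iff by blast+
    ultimately obtain \<phi> where "\<phi> \<in> pseudo_arrows X (pixels X Y) (s P) (s Q)"
      using pseudo_arrow_exists by blast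
    then have "pre_digraph.awalk quiver P [(P, \<phi>, Q)] Q"
      using assms by (simp add: pre_digraph.awalk_def pre_digraph.cas.simps pixel_quiver_def)
    then show ?thesis ..
  qed
qed

definition walks :: "'a set set \<Rightarrow> 'a set set \<Rightarrow> _" where
  "walks P Q = {(P, p, Q) | p. pre_digraph.awalk quiver P p Q}"

lemma walks_eq_empty_iff:
  assumes "P \<in> pixels X Y" "Q \<in> pixels X Y"
  shows "walks P Q = {} \<longleftrightarrow> \<not> s P \<inter> Y \<subseteq> s Q \<inter> Y"
  unfolding awalk_exists_iff[OF assms, symmetric] walks_def by blast

lemma Ob_pixelation: "Ob (pixelation X (pixels X Y) s) = pixels X Y"
  by (simp add: pixelation_def quotient_cat_def free_cat_def pixel_quiver_def)

lemma Mor_free_cat: "Mor (free_cat quiver) P Q = walks P Q"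
  by (simp add: free_cat_def walks_def)

text \<open>By \<open>awalk_value\<close> the image of a walk under \<open>pixel_Psi\<close> depends
  on its ends only, so all parallel walks are identified. The set \<open>walks P Q\<close>, if
  nonempty, is itself the morphism of the quotient.\<close>

lemma parallel_rel_walks:
  "parallel_rel (free_cat quiver) (pixel_Psi X (pixels X Y) s) P Q = walks P Q \<times> walks P Q"
  unfolding parallel_rel_def Mor_free_cat by (auto simp: walks_def awalk_value(1))

lemma Mor_pixelation_iff:
  "f \<in> Mor (pixelation X (pixels X Y) s) P Q \<longleftrightarrow> f = walks P Q \<and> walks P Q \<noteq> {}"
proof -
  have "walks P Q // (walks P Q \<times> walks P Q) = (if walks P Q = {} then {} else {walks P Q})"
    by (auto simp: quotient_def)
  then show ?thesis
    by (simp add: pixelation_def quotient_cat_def parallel_rel_walks Mor_free_cat)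
qed

lemma Comp_pixelation:
  assumes "P \<in> pixels X Y" "Q \<in> pixels X Y" "R \<in> pixels X Y" "walks P Q \<noteq> {}" "walks Q R \<noteq> {}"
  shows "Comp (pixelation X (pixels X Y) s) (walks Q R) (walks P Q) = walks P R \<and> walks P R \<noteq> {}"
proof -
  let ?F = "free_cat quiver"
  have comp: "Comp ?F g f \<in> walks P R" if "f \<in> walks P Q" "g \<in> walks Q R" for f g
  proof -
    obtain p q where "f = (P, p, Q)" "g = (Q, q, R)"
      "pre_digraph.awalk quiver P p Q" "pre_digraph.awalk quiver Q q R"
      using \<open>f \<in> walks P Q\<close> \<open>g \<in> walks Q R\<close> by (auto simp: walks_def)
    moreover from this have "pre_digraph.awalk quiver P (p @ q) R"
      by (auto simp: pre_digraph.awalk_def intro: cas_append)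
    ultimately show ?thesis
      by (simp add: free_cat_def walks_def)
  qed
  let ?S = "{parallel_rel ?F (pixel_Psi X (pixels X Y) s) a c `` {Comp ?F g f} | a b c f g.
        {a, b, c} \<subseteq> Ob ?F \<and> f \<in> walks P Q \<and> f \<in> Mor ?F a b \<and> g \<in> walks Q R \<and> g \<in> Mor ?F b c}"
  have const: "x = walks P R" if x: "x \<in> ?S" for x
  proof -
    obtain a b c f g where *: "x = parallel_rel ?F (pixel_Psi X (pixels X Y) s) a c `` {Comp ?F g f}"
      "f \<in> walks P Q" "f \<in> walks a b" "g \<in> walks Q R" "g \<in> walks b c"
      using x unfolding mem_Collect_eq Mor_free_cat by (elim exE conjE) (rule that)
    \<comment> \<open>The triples of \<open>free_cat\<close> carry their ends, which pins down the
      freshly quantified objects.\<close>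
    then have "a = P" "c = R"
      by (auto simp: walks_def)
    then show ?thesis
      using *(1) comp[OF *(2,4)] by (simp add: parallel_rel_walks Image_singleton)
  qed
  obtain f g where fg: "f \<in> walks P Q" "g \<in> walks Q R"
    using assms by blast
  have Ob: "{P, Q, R} \<subseteq> Ob ?F"
    using assms by (simp add: free_cat_def pixel_quiver_def)
  have "parallel_rel ?F (pixel_Psi X (pixels X Y) s) P R `` {Comp ?F g f} \<in> ?S"
    unfolding Mor_free_cat mem_Collect_eq
    by (rule exI[of _ P], rule exI[of _ Q], rule exI[of _ R],
        rule exI[of _ f], rule exI[of _ g]) (use fg Ob in simp)
  with const have "\<Union>?S = walks P R"
    by (rule Union_constant)
  moreover have "walks P R \<noteq> {}"
    using comp[OF fg] by blast
  ultimately show ?thesis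
    by (simp add: pixelation_def quotient_cat_def)
qed

lemma category_pixelation: "category (pixelation X (pixels X Y) s)"
proof (rule thin_category, unfold Ob_pixelation Mor_pixelation_iff)
  show "P = P' \<and> Q = Q'" if "f = walks P Q \<and> walks P Q \<noteq> {}" "f = walks P' Q' \<and> walks P' Q' \<noteq> {}"
    for P Q P' Q' f
  proof -
    have "walks P Q = walks P' Q'" "walks P Q \<noteq> {}"
      using that by metis+
    then obtain x where "x \<in> walks P Q" "x \<in> walks P' Q'"
      by blast
    then show ?thesis
      by (auto simp: walks_def)
  qed
  show "Ident (pixelation X (pixels X Y) s) P = walks P P \<and> walks P P \<noteq> {}"
    if P: "P \<in> pixels X Y" for P
  proof -
    have "Ident (free_cat quiver) P \<in> walks P P"
      using P by (simp add: free_cat_def walks_def pre_digraph.awalk_def pre_digraph.cas.simps pixel_quiver_def)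
    moreover from this have "Ident (pixelation X (pixels X Y) s) P = walks P P"
      by (simp add: pixelation_def quotient_cat_def parallel_rel_walks Image_singleton)
    ultimately show ?thesis
      by blast
  qed
  show "Comp (pixelation X (pixels X Y) s) g f = walks P R \<and> walks P R \<noteq> {}"
    if "P \<in> pixels X Y" "Q \<in> pixels X Y" "R \<in> pixels X Y"
      and f: "f = walks P Q \<and> walks P Q \<noteq> {}" and g: "g = walks Q R \<and> walks Q R \<noteq> {}" for P Q R f g
    unfolding conjunct1[OF f] conjunct1[OF g]
    by (rule Comp_pixelation[OF that(1-3) conjunct2[OF f] conjunct2[OF g]])
qed simp

text \<open>Open sets of the subspace are the traces of open sets of X, that is, the Z whose pixel
  is nonempty; taking the trace of the chosen object inverts \<open>pixel X Y\<close>.\<close>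

lemma bij_betw_pixel:
  "bij_betw (pixel X Y) {Z. openin (subtopology X Y) Z} (pixels X Y)"
proof (rule bij_betw_byWitness[where f' = "\<lambda>P. s P \<inter> Y"])
  show "\<forall>P \<in> pixels X Y. pixel X Y (s P \<inter> Y) = P"
    using pixels_iff by metis
  show "(\<lambda>P. s P \<inter> Y) ` pixels X Y \<subseteq> {Z. openin (subtopology X Y) Z}"
    using pixels_iff by (auto simp: openin_subtopology)
qed (use choice_pixel_Int in \<open>auto simp: openin_subtopology\<close>)

text \<open>T is an arbitrary model of the subspace, so that h may be the identity or a contraction
  of primes. The homeomorphism enters through the order isomorphism that it induces between the
  families of open sets.\<close>

theorem Top_isomorphism_pixelation:
  assumes "homeomorphic_map T (subtopology X Y) h"
  shows "\<exists>F1. cat_isomorphism (Top T) (pixelation X (pixels X Y) s) (\<lambda>U. pixel X Y (h ` U)) F1"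
proof (rule thin_isomorphism)
  obtain g where hg: "homeomorphic_maps T (subtopology X Y) h g"
    using assms homeomorphic_map_maps by blast
  then have g: "homeomorphic_map (subtopology X Y) T g"
    using homeomorphic_maps_map by blast
  have gh: "g ` h ` U = U" if "openin T U" for U
  proof -
    have "g (h x) = x" if "x \<in> U" for x
      using openin_subset[OF \<open>openin _ U\<close>] hg that by (auto simp: homeomorphic_maps_def)
    then show ?thesis
      by (simp add: image_image)
  qed
  have hg': "h ` g ` Z = Z" if "openin (subtopology X Y) Z" for Z
  proof -
    have "h (g x) = x" if "x \<in> Z" for x
      using openin_subset[OF \<open>openin _ Z\<close>] hg that by (auto simp: homeomorphic_maps_def)
    then show ?thesis
      by (simp add: image_image)
  qed
  have h_open: "openin (subtopology X Y) (h ` U)" if "openin T U" for U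
    using homeomorphic_imp_open_map[OF assms] that by (simp add: open_map_def)
  have g_open: "openin T (g ` Z)" if "openin (subtopology X Y) Z" for Z
    using homeomorphic_imp_open_map[OF g] that by (simp add: open_map_def)
  have "bij_betw ((`) h) {U. openin T U} {Z. openin (subtopology X Y) Z}"
    by (rule bij_betw_byWitness[where f' = "(`) g"]) (use gh hg' h_open g_open in auto)
  then have "bij_betw (pixel X Y \<circ> (`) h) {U. openin T U} (pixels X Y)"
    using bij_betw_pixel by (rule bij_betw_trans)
  then show "bij_betw (\<lambda>U. pixel X Y (h ` U)) (Ob (Top T)) (Ob (pixelation X (pixels X Y) s))"
    by (simp add: Top_def Ob_pixelation comp_def)
  show "Mor (Top T) U V = {} \<longleftrightarrow>
      Mor (pixelation X (pixels X Y) s) (pixel X Y (h ` U)) (pixel X Y (h ` V)) = {}"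
    if "U \<in> Ob (Top T)" "V \<in> Ob (Top T)" for U V
  proof -
    have op: "openin T U" "openin T V"
      using that by (simp_all add: Top_def)
    have s_pixel: "pixel X Y Z \<in> pixels X Y \<and> s (pixel X Y Z) \<inter> Y = Z"
      if "openin (subtopology X Y) Z" for Z
      using that choice_pixel_Int by (auto simp: openin_subtopology)
    have "walks (pixel X Y (h ` U)) (pixel X Y (h ` V)) = {} \<longleftrightarrow> \<not> h ` U \<subseteq> h ` V"
      using walks_eq_empty_iff s_pixel[OF h_open[OF op(1)]] s_pixel[OF h_open[OF op(2)]] by metis
    moreover have "h ` U \<subseteq> h ` V \<longleftrightarrow> U \<subseteq> V"
      using gh[OF op(1)] gh[OF op(2)] by (metis image_mono)
    moreover have "Mor (Top T) U V = {} \<longleftrightarrow> \<not> U \<subseteq> V"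
      using op by (auto simp: Top_def)
    moreover have "Mor (pixelation X (pixels X Y) s) P Q = {} \<longleftrightarrow> walks P Q = {}" for P Q
      using Mor_pixelation_iff by blast
    ultimately show ?thesis
      by simp
  qed
  show "f = g" if "f \<in> Mor (Top T) U V" "g \<in> Mor (Top T) U V" for U V f g
    using that by (auto simp: Top_def)
qed (simp_all add: category_Top category_pixelation Mor_pixelation_iff)

end

section \<open>Localization of a commutative ring\<close>

text \<open>The case of 0 in S is included: L is then the zero ring, its spectrum is empty, and no
  prime of R avoids S.\<close>

locale ring_localization_setting = R: cring R + S: submonoid S R
  for R :: "('a, 'b) ring_scheme" (structure) and S
begin

abbreviation frac where "frac \<equiv> ring_fraction R S"
abbreviation L where "L \<equiv> ring_localization R S"

lemma S_carrier [intro]: "s \<in> S \<Longrightarrow> s \<in> carrier R"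
  using S.subset by blast

text \<open>With the subtracted term moved to the other side, only products remain, and transitivity
  becomes a regrouping of factors with \<open>R.m_ac\<close>.\<close>

lemma ring_fraction_rel_iff:
  "((r, s), (r', s')) \<in> ring_fraction_rel R S \<longleftrightarrow>
     r \<in> carrier R \<and> s \<in> S \<and> r' \<in> carrier R \<and> s' \<in> S \<and>
     (\<exists>t \<in> S. t \<otimes> (r \<otimes> s') = t \<otimes> (r' \<otimes> s))"
proof -
  have "t \<otimes> (r \<otimes> s' \<ominus> r' \<otimes> s) = \<zero> \<longleftrightarrow> t \<otimes> (r \<otimes> s') = t \<otimes> (r' \<otimes> s)"
    if "t \<in> carrier R" "r \<in> carrier R" "s \<in> carrier R" "r' \<in> carrier R" "s' \<in> carrier R" for t
  proof -
    have "t \<otimes> (r \<otimes> s' \<ominus> r' \<otimes> s) = t \<otimes> (r \<otimes> s') \<ominus> t \<otimes> (r' \<otimes> s)"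
      using that by (simp add: R.minus_eq R.r_distr R.r_minus)
    then show ?thesis
      using that by simp
  qed
  then show ?thesis
    unfolding ring_fraction_rel_def using S_carrier by auto
qed

lemma equiv_ring_fraction_rel: "equiv (carrier R \<times> S) (ring_fraction_rel R S)"
proof (rule equivI)
  show "ring_fraction_rel R S \<subseteq> (carrier R \<times> S) \<times> (carrier R \<times> S)"
    by (auto simp: ring_fraction_rel_def)
  show "refl_on (carrier R \<times> S) (ring_fraction_rel R S)"
    by (rule refl_onI) (auto simp: ring_fraction_rel_iff intro: S.one_closed)
  show "sym (ring_fraction_rel R S)"
    by (rule symI) (auto simp: ring_fraction_rel_iff, metis)
  show "trans (ring_fraction_rel R S)"
  proof (rule transI, clarify)
    fix r s r' s' r'' s''
    assume "((r, s), (r', s')) \<in> ring_fraction_rel R S" "((r', s'), (r'', s'')) \<in> ring_fraction_rel R S"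
    then obtain t t' where S: "r \<in> carrier R" "s \<in> S" "r' \<in> carrier R" "s' \<in> S" "r'' \<in> carrier R" "s'' \<in> S"
        "t \<in> S" "t' \<in> S"
      and eq: "t \<otimes> (r \<otimes> s') = t \<otimes> (r' \<otimes> s)" "t' \<otimes> (r' \<otimes> s'') = t' \<otimes> (r'' \<otimes> s')"
      by (auto simp: ring_fraction_rel_iff)
    \<comment> \<open>The multiplier contains s' so that r s', and then r' s'', occur as factors to
      which the given equations apply.\<close>
    have "(t \<otimes> t' \<otimes> s') \<otimes> (r \<otimes> s'') = (t \<otimes> (r \<otimes> s')) \<otimes> (t' \<otimes> s'')"
      using S S_carrier by (simp add: R.m_ac)
    also have "\<dots> = (t' \<otimes> (r' \<otimes> s'')) \<otimes> (t \<otimes> s)"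
      unfolding eq(1) using S S_carrier by (simp add: R.m_ac)
    also have "\<dots> = (t \<otimes> t' \<otimes> s') \<otimes> (r'' \<otimes> s)"
      unfolding eq(2) using S S_carrier by (simp add: R.m_ac)
    finally show "((r, s), (r'', s'')) \<in> ring_fraction_rel R S"
      using S S.m_closed unfolding ring_fraction_rel_iff by blast
  qed
qed

lemma frac_eq_iff:
  assumes "r \<in> carrier R" "s \<in> S" "r' \<in> carrier R" "s' \<in> S"
  shows "frac r s = frac r' s' \<longleftrightarrow> (\<exists>t \<in> S. t \<otimes> (r \<otimes> s') = t \<otimes> (r' \<otimes> s))"
  using eq_equiv_class_iff[OF equiv_ring_fraction_rel, of "(r, s)" "(r', s')"] assms
  by (simp add: ring_fraction_def ring_fraction_rel_iff)

lemma mem_frac_iff: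
  assumes "r \<in> carrier R" "s \<in> S"
  shows "(r', s') \<in> frac r s \<longleftrightarrow> r' \<in> carrier R \<and> s' \<in> S \<and> frac r' s' = frac r s"
proof -
  have "(r', s') \<in> frac r s \<longleftrightarrow> r' \<in> carrier R \<and> s' \<in> S \<and> (\<exists>t \<in> S. t \<otimes> (r \<otimes> s') = t \<otimes> (r' \<otimes> s))"
    using assms by (simp add: ring_fraction_def ring_fraction_rel_iff)
  then show ?thesis
    using assms frac_eq_iff[of r s r' s'] by metis
qed

lemma frac_eqI:
  assumes "r \<in> carrier R" "s \<in> S" "r' \<in> carrier R" "s' \<in> S" "r \<otimes> s' = r' \<otimes> s"
  shows "frac r s = frac r' s'"
  using assms S.one_closed by (subst frac_eq_iff) auto

section \<open>The ring structure on fractions\<close>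

lemma carrier_ring_localization: "carrier L = {frac r s | r s. r \<in> carrier R \<and> s \<in> S}"
  by (auto simp: ring_localization_def quotient_def ring_fraction_def)

lemma fracE:
  assumes "x \<in> carrier L"
  obtains r s where "r \<in> carrier R" "s \<in> S" "x = frac r s"
  using assms unfolding carrier_ring_localization by blast

lemma frac_closed [simp]: "r \<in> carrier R \<Longrightarrow> s \<in> S \<Longrightarrow> frac r s \<in> carrier L"
  unfolding carrier_ring_localization by blast

lemma frac_mult_cong:
  assumes "a \<in> carrier R" "s \<in> S" "a' \<in> carrier R" "s' \<in> S" "frac a s = frac a' s'"
    and "b \<in> carrier R" "t \<in> S" "b' \<in> carrier R" "t' \<in> S" "frac b t = frac b' t'"
  shows "frac (a \<otimes> b) (s \<otimes> t) = frac (a' \<otimes> b') (s' \<otimes> t')"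
proof -
  obtain u where u: "u \<in> S" "u \<otimes> (a \<otimes> s') = u \<otimes> (a' \<otimes> s)"
    using frac_eq_iff[OF assms(1-4)] assms(5) by blast
  obtain v where v: "v \<in> S" "v \<otimes> (b \<otimes> t') = v \<otimes> (b' \<otimes> t)"
    using frac_eq_iff[OF assms(6-9)] assms(10) by blast
  note in_R = assms u(1) v(1) S_carrier
  have "(u \<otimes> v) \<otimes> (a \<otimes> b \<otimes> (s' \<otimes> t')) = (u \<otimes> (a \<otimes> s')) \<otimes> (v \<otimes> (b \<otimes> t'))"
    using in_R by (simp add: R.m_ac)
  also have "\<dots> = (u \<otimes> v) \<otimes> (a' \<otimes> b' \<otimes> (s \<otimes> t))"
    unfolding u(2) v(2) using in_R by (simp add: R.m_ac)
  finally show ?thesis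
    using in_R S.m_closed by (subst frac_eq_iff) auto
qed

lemma frac_add_cong:
  assumes "a \<in> carrier R" "s \<in> S" "a' \<in> carrier R" "s' \<in> S" "frac a s = frac a' s'"
    and "b \<in> carrier R" "t \<in> S" "b' \<in> carrier R" "t' \<in> S" "frac b t = frac b' t'"
  shows "frac (a \<otimes> t \<oplus> b \<otimes> s) (s \<otimes> t) = frac (a' \<otimes> t' \<oplus> b' \<otimes> s') (s' \<otimes> t')"
proof -
  obtain u where u: "u \<in> S" "u \<otimes> (a \<otimes> s') = u \<otimes> (a' \<otimes> s)"
    using frac_eq_iff[OF assms(1-4)] assms(5) by blast
  obtain v where v: "v \<in> S" "v \<otimes> (b \<otimes> t') = v \<otimes> (b' \<otimes> t)"
    using frac_eq_iff[OF assms(6-9)] assms(10) by blast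
  note in_R = assms u(1) v(1) S_carrier
  \<comment> \<open>The common multiplier u v lets each summand be regrouped around the left side of
    one of the two given equations.\<close>
  have "(u \<otimes> v) \<otimes> ((a \<otimes> t \<oplus> b \<otimes> s) \<otimes> (s' \<otimes> t')) =
      (u \<otimes> (a \<otimes> s')) \<otimes> (v \<otimes> t \<otimes> t') \<oplus> (v \<otimes> (b \<otimes> t')) \<otimes> (u \<otimes> s \<otimes> s')"
    using in_R by (simp add: R.m_ac R.l_distr R.r_distr)
  also have "\<dots> = (u \<otimes> v) \<otimes> ((a' \<otimes> t' \<oplus> b' \<otimes> s') \<otimes> (s \<otimes> t))"
    unfolding u(2) v(2) using in_R by (simp add: R.m_ac R.l_distr R.r_distr)
  finally show ?thesis
    using in_R S.m_closed by (subst frac_eq_iff) auto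
qed

text \<open>By the congruence the defining union is constant. As a simp rule, together with
  \<open>frac_add\<close>, it reduces the ring axioms to representatives.\<close>

lemma frac_mult [simp]:
  assumes "a \<in> carrier R" "s \<in> S" "b \<in> carrier R" "t \<in> S"
  shows "frac a s \<otimes>\<^bsub>L\<^esub> frac b t = frac (a \<otimes> b) (s \<otimes> t)"
proof -
  have "x = frac (a \<otimes> b) (s \<otimes> t)"
    if x: "x \<in> {frac (r \<otimes> r') (s1 \<otimes> s2) | r s1 r' s2. (r, s1) \<in> frac a s \<and> (r', s2) \<in> frac b t}" for x
  proof -
    obtain r s1 r' s2 where "x = frac (r \<otimes> r') (s1 \<otimes> s2)" "(r, s1) \<in> frac a s" "(r', s2) \<in> frac b t"
      using x by blast
    then show ?thesis
      using frac_mult_cong[of r s1 a s r' s2 b t] mem_frac_iff[OF assms(1,2)] mem_frac_iff[OF assms(3,4)] assms by simp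
  qed
  moreover have "frac (a \<otimes> b) (s \<otimes> t) \<in> {frac (r \<otimes> r') (s1 \<otimes> s2) | r s1 r' s2. (r, s1) \<in> frac a s \<and> (r', s2) \<in> frac b t}"
    using assms by (force simp: mem_frac_iff)
  ultimately have "\<Union>{frac (r \<otimes> r') (s1 \<otimes> s2) | r s1 r' s2. (r, s1) \<in> frac a s \<and> (r', s2) \<in> frac b t} = frac (a \<otimes> b) (s \<otimes> t)"
    by (rule Union_constant)
  then show ?thesis
    by (simp add: ring_localization_def)
qed

lemma frac_add [simp]:
  assumes "a \<in> carrier R" "s \<in> S" "b \<in> carrier R" "t \<in> S"
  shows "frac a s \<oplus>\<^bsub>L\<^esub> frac b t = frac (a \<otimes> t \<oplus> b \<otimes> s) (s \<otimes> t)"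
proof -
  have "x = frac (a \<otimes> t \<oplus> b \<otimes> s) (s \<otimes> t)"
    if x: "x \<in> {frac (r \<otimes> s2 \<oplus> r' \<otimes> s1) (s1 \<otimes> s2) | r s1 r' s2. (r, s1) \<in> frac a s \<and> (r', s2) \<in> frac b t}" for x
  proof -
    obtain r s1 r' s2 where "x = frac (r \<otimes> s2 \<oplus> r' \<otimes> s1) (s1 \<otimes> s2)" "(r, s1) \<in> frac a s" "(r', s2) \<in> frac b t"
      using x by blast
    then show ?thesis
      using frac_add_cong[of r s1 a s r' s2 b t] mem_frac_iff[OF assms(1,2)] mem_frac_iff[OF assms(3,4)] assms by simp
  qed
  moreover have "frac (a \<otimes> t \<oplus> b \<otimes> s) (s \<otimes> t) \<in> {frac (r \<otimes> s2 \<oplus> r' \<otimes> s1) (s1 \<otimes> s2) | r s1 r' s2. (r, s1) \<in> frac a s \<and> (r', s2) \<in> frac b t}"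
    using assms by (force simp: mem_frac_iff)
  ultimately have "\<Union>{frac (r \<otimes> s2 \<oplus> r' \<otimes> s1) (s1 \<otimes> s2) | r s1 r' s2. (r, s1) \<in> frac a s \<and> (r', s2) \<in> frac b t} = frac (a \<otimes> t \<oplus> b \<otimes> s) (s \<otimes> t)"
    by (rule Union_constant)
  then show ?thesis
    by (simp add: ring_localization_def)
qed

lemma one_ring_localization: "\<one>\<^bsub>L\<^esub> = frac \<one> \<one>" and zero_ring_localization: "\<zero>\<^bsub>L\<^esub> = frac \<zero> \<one>"
  by (simp_all add: ring_localization_def)

lemma frac_zero: "s \<in> S \<Longrightarrow> frac \<zero> s = \<zero>\<^bsub>L\<^esub>"
  unfolding zero_ring_localization by (rule frac_eqI) auto

lemma cring_ring_localization: "cring L"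
proof (rule cringI)
  show "abelian_group L"
  proof (rule abelian_groupI)
    show "\<zero>\<^bsub>L\<^esub> \<in> carrier L"
      by (simp add: zero_ring_localization)
    fix x assume "x \<in> carrier L"
    then obtain a s where x: "a \<in> carrier R" "s \<in> S" "x = frac a s"
      by (rule fracE)
    show "\<zero>\<^bsub>L\<^esub> \<oplus>\<^bsub>L\<^esub> x = x"
      using x S_carrier by (simp add: zero_ring_localization)
    have "frac (\<ominus> a) s \<oplus>\<^bsub>L\<^esub> x = frac ((\<ominus> a \<oplus> a) \<otimes> s) (s \<otimes> s)"
      using x S_carrier by (simp add: R.l_distr del: R.l_neg)
    also have "\<dots> = \<zero>\<^bsub>L\<^esub>"
      using x S_carrier by (simp add: R.l_neg frac_zero)
    finally show "\<exists>y \<in> carrier L. y \<oplus>\<^bsub>L\<^esub> x = \<zero>\<^bsub>L\<^esub>"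
      using x by (intro bexI[of _ "frac (\<ominus> a) s"]) simp_all
    fix y assume "y \<in> carrier L"
    then obtain b t where y: "b \<in> carrier R" "t \<in> S" "y = frac b t"
      by (rule fracE)
    show "x \<oplus>\<^bsub>L\<^esub> y \<in> carrier L"
      using x y S_carrier by simp
    show "x \<oplus>\<^bsub>L\<^esub> y = y \<oplus>\<^bsub>L\<^esub> x"
      using x y S_carrier by (simp add: R.a_ac R.m_ac)
    fix z assume "z \<in> carrier L"
    then obtain c u where z: "c \<in> carrier R" "u \<in> S" "z = frac c u"
      by (rule fracE)
    show "x \<oplus>\<^bsub>L\<^esub> y \<oplus>\<^bsub>L\<^esub> z = x \<oplus>\<^bsub>L\<^esub> (y \<oplus>\<^bsub>L\<^esub> z)"
      using x y z S_carrier by (simp add: R.a_ac R.m_ac R.l_distr R.r_distr)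
  qed
  show "comm_monoid L"
  proof (rule comm_monoidI)
    show "\<one>\<^bsub>L\<^esub> \<in> carrier L"
      by (simp add: one_ring_localization)
  qed (auto elim!: fracE simp: one_ring_localization R.m_ac S_carrier)
  fix x y z assume "x \<in> carrier L" "y \<in> carrier L" "z \<in> carrier L"
  then obtain a s b t c u where abc: "a \<in> carrier R" "s \<in> S" "x = frac a s"
    "b \<in> carrier R" "t \<in> S" "y = frac b t" "c \<in> carrier R" "u \<in> S" "z = frac c u"
    by (elim fracE)
  show "(x \<oplus>\<^bsub>L\<^esub> y) \<otimes>\<^bsub>L\<^esub> z = x \<otimes>\<^bsub>L\<^esub> z \<oplus>\<^bsub>L\<^esub> y \<otimes>\<^bsub>L\<^esub> z"
  proof -
    \<comment> \<open>Computed on representatives, the two sides have denominators s t u and s u t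
      u. They differ by a factor u, so the law holds for fractions while the representatives may
      differ.\<close>
    have "frac ((a \<otimes> t \<oplus> b \<otimes> s) \<otimes> c) (s \<otimes> t \<otimes> u) =
        frac (a \<otimes> c \<otimes> (t \<otimes> u) \<oplus> b \<otimes> c \<otimes> (s \<otimes> u)) (s \<otimes> u \<otimes> (t \<otimes> u))"
      by (rule frac_eqI) (use abc S_carrier in \<open>simp_all add: R.m_ac R.l_distr R.r_distr\<close>)
    then show ?thesis
      using abc S_carrier by simp
  qed
qed

lemma frac_one_ring_hom: "(\<lambda>r. frac r \<one>) \<in> ring_hom R L"
  by (rule ring_hom_memI) (simp_all add: one_ring_localization)

section \<open>Primes of the localization\<close>

lemma primeideal_contraction:
  assumes "primeideal \<qq> L"
  shows "primeideal (contraction R S \<qq>) R"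
proof -
  interpret L: cring L
    by (rule cring_ring_localization)
  interpret ring_hom_ring R L "\<lambda>r. frac r \<one>"
    by unfold_locales (rule frac_one_ring_hom)
  show ?thesis
    using primeideal_vimage[OF R.is_cring assms] by (simp add: contraction_def)
qed

text \<open>The element s/1 is a unit with inverse 1/s: multiplying by the one clears the
  denominator, by the other restores it. Ideals of L are thus determined by their
  numerators.\<close>

lemma frac_mem_ideal_iff:
  assumes "ideal \<qq> L" "r \<in> carrier R" "s \<in> S"
  shows "frac r s \<in> \<qq> \<longleftrightarrow> frac r \<one> \<in> \<qq>"
proof -
  interpret ideal \<qq> L by fact
  have "frac s \<one> \<otimes>\<^bsub>L\<^esub> frac r s = frac (s \<otimes> r) s" "frac \<one> s \<otimes>\<^bsub>L\<^esub> frac r \<one> = frac r s"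
    using assms S_carrier by simp_all
  moreover have "frac (s \<otimes> r) s = frac r \<one>"
    by (rule frac_eqI) (use assms S_carrier in \<open>simp_all add: R.m_comm\<close>)
  moreover have "frac r s \<in> carrier L" "frac r \<one> \<in> carrier L" "frac s \<one> \<in> carrier L" "frac \<one> s \<in> carrier L"
    using assms S_carrier by simp_all
  ultimately show ?thesis
    using I_l_closed by metis
qed

text \<open>An s of S in the contraction would put s/1, hence s/s = 1, into \<qq>, against
  properness.\<close>

lemma contraction_disjoint:
  assumes "primeideal \<qq> L"
  shows "S \<inter> contraction R S \<qq> = {}"
proof (rule ccontr)
  interpret primeideal \<qq> L by fact
  assume "S \<inter> contraction R S \<qq> \<noteq> {}"
  then obtain s where s: "s \<in> S" "frac s \<one> \<in> \<qq>"
    by (auto simp: contraction_def)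
  then have "frac s s \<in> \<qq>"
    using frac_mem_ideal_iff[OF ideal_axioms] S_carrier by blast
  moreover have "frac s s = \<one>\<^bsub>L\<^esub>"
    unfolding one_ring_localization using s S_carrier frac_eqI[of s s \<one> \<one>] by simp
  ultimately show False
    using one_imp_carrier I_notcarr by simp
qed

text \<open>The extended ideal, given by single fractions instead of sums of generators: sums
  brought to a common denominator already have this form.\<close>

definition extension :: "'a set \<Rightarrow> ('a \<times> 'a) set set" where
  "extension \<pp> = {frac r s | r s. r \<in> \<pp> \<and> s \<in> S}"

text \<open>From r/s = r'/s' comes t r s' = t r' s in \<pp>; neither t nor s' lies in \<pp>, so
  primality leaves r. Membership is thus independent of the representative, and claims on the
  extension become claims on numerators.\<close>

lemma frac_mem_extension_iff:
  assumes "primeideal \<pp> R" "S \<inter> \<pp> = {}" "r \<in> carrier R" "s \<in> S"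
  shows "frac r s \<in> extension \<pp> \<longleftrightarrow> r \<in> \<pp>"
proof
  interpret primeideal \<pp> R by fact
  assume "frac r s \<in> extension \<pp>"
  then obtain r' s' where r': "r' \<in> \<pp>" "s' \<in> S" "frac r s = frac r' s'"
    by (auto simp: extension_def)
  then obtain t where t: "t \<in> S" "t \<otimes> (r \<otimes> s') = t \<otimes> (r' \<otimes> s)"
    using frac_eq_iff[of r s r' s'] assms a_subset by blast
  have "t \<otimes> (r' \<otimes> s) \<in> \<pp>"
    using r'(1) t(1) assms(4) S_carrier by (simp add: I_l_closed I_r_closed)
  then have "t \<in> \<pp> \<or> r \<in> \<pp> \<or> s' \<in> \<pp>"
    using t I_prime assms(3) r'(2) S_carrier R.m_closed by metis
  then show "r \<in> \<pp>"
    using t(1) r'(2) assms(2) by blast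
qed (use assms in \<open>auto simp: extension_def\<close>)

lemma primeideal_extension:
  assumes p: "primeideal \<pp> R" "S \<inter> \<pp> = {}"
  shows "primeideal (extension \<pp>) L"
proof -
  interpret P: primeideal \<pp> R by fact
  interpret L: cring L
    by (rule cring_ring_localization)
  note mem = frac_mem_extension_iff[OF p]
  have sub: "extension \<pp> \<subseteq> carrier L"
    using P.a_subset by (auto simp: extension_def)
  show ?thesis
  proof (rule primeidealI2)
    show "additive_subgroup (extension \<pp>) L"
    proof (rule additive_subgroupI, rule L.add.subgroupI)
      show "extension \<pp> \<noteq> {}"
        using mem[of \<zero> \<one>] by auto
      fix x assume "x \<in> extension \<pp>"
      then obtain a s where x: "a \<in> \<pp>" "s \<in> S" "x = frac a s"
        by (auto simp: extension_def)
      have a: "a \<in> carrier R"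
        using x(1) P.a_subset by blast
      have "frac (\<ominus> a) s \<oplus>\<^bsub>L\<^esub> x = frac ((\<ominus> a \<oplus> a) \<otimes> s) (s \<otimes> s)"
        using x a S_carrier by (simp add: R.l_distr del: R.l_neg)
      also have "\<dots> = \<zero>\<^bsub>L\<^esub>"
        using x a S_carrier by (simp add: R.l_neg frac_zero)
      finally have "\<ominus>\<^bsub>L\<^esub> x = frac (\<ominus> a) s"
        using x a by (intro L.minus_equality) auto
      then show "\<ominus>\<^bsub>L\<^esub> x \<in> extension \<pp>"
        using mem[of "\<ominus> a" s] x a by simp
      fix y assume "y \<in> extension \<pp>"
      then obtain b t where y: "b \<in> \<pp>" "t \<in> S" "y = frac b t"
        by (auto simp: extension_def)
      have b: "b \<in> carrier R"
        using y(1) P.a_subset by blast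
      have "a \<otimes> t \<oplus> b \<otimes> s \<in> \<pp>"
        using x y S_carrier by (simp add: P.I_r_closed)
      then show "x \<oplus>\<^bsub>L\<^esub> y \<in> extension \<pp>"
        using x y a b S_carrier mem by simp
    qed (use sub in simp)
    show "cring L" by (rule cring_ring_localization)
    fix x y assume xy: "y \<in> carrier L"
    then obtain b t where y: "b \<in> carrier R" "t \<in> S" "y = frac b t"
      by (elim fracE)
    show "y \<otimes>\<^bsub>L\<^esub> x \<in> extension \<pp>" "x \<otimes>\<^bsub>L\<^esub> y \<in> extension \<pp>" if x': "x \<in> extension \<pp>"
    proof -
      obtain a s where x: "a \<in> \<pp>" "s \<in> S" "x = frac a s"
        using x' by (auto simp: extension_def)
      moreover have "a \<in> carrier R"
        using x(1) P.a_subset by blast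
      ultimately show "y \<otimes>\<^bsub>L\<^esub> x \<in> extension \<pp>" "x \<otimes>\<^bsub>L\<^esub> y \<in> extension \<pp>"
        using y mem by (simp_all add: P.I_l_closed P.I_r_closed)
    qed
    show "x \<in> extension \<pp> \<or> y \<in> extension \<pp>" if x': "x \<in> carrier L" "x \<otimes>\<^bsub>L\<^esub> y \<in> extension \<pp>"
    proof -
      obtain a s where x: "a \<in> carrier R" "s \<in> S" "x = frac a s"
        using x'(1) by (elim fracE)
      then show ?thesis
        using y x'(2) mem P.I_prime by simp
    qed
  next
    have "\<one> \<notin> \<pp>"
      using p(2) S.one_closed by blast
    then have "frac \<one> \<one> \<notin> extension \<pp>"
      using mem by simp
    moreover have "frac \<one> \<one> \<in> carrier L"
      by simp
    ultimately show "carrier L \<noteq> extension \<pp>"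
      by metis
  qed
qed

lemma contraction_extension:
  assumes "primeideal \<pp> R" "S \<inter> \<pp> = {}"
  shows "contraction R S (extension \<pp>) = \<pp>"
proof -
  interpret primeideal \<pp> R by fact
  show ?thesis
    using frac_mem_extension_iff[OF assms] a_subset by (auto simp: contraction_def)
qed

text \<open>Denominators are invertible, so r/s in \<qq> gives r/1 in \<qq>, which places the
  numerator r in the contraction.\<close>

lemma extension_contraction:
  assumes "ideal \<qq> L"
  shows "extension (contraction R S \<qq>) = \<qq>"
proof -
  interpret ideal \<qq> L by fact
  have "x \<in> \<qq>" if "x \<in> extension (contraction R S \<qq>)" for x
    using that frac_mem_ideal_iff[OF assms] by (auto simp: extension_def contraction_def)
  moreover have "x \<in> extension (contraction R S \<qq>)" if x: "x \<in> \<qq>" for x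
  proof -
    have "x \<in> carrier L"
      using x a_subset by blast
    then obtain r s where r: "r \<in> carrier R" "s \<in> S" "x = frac r s"
      by (rule fracE)
    then have "r \<in> contraction R S \<qq>"
      using x frac_mem_ideal_iff[OF assms r(1,2)] by (simp add: contraction_def)
    then show ?thesis
      using r unfolding extension_def by blast
  qed
  ultimately show ?thesis
    by blast
qed

lemma bij_betw_contraction:
  "bij_betw (contraction R S) (Spec L) {\<pp> \<in> Spec R. S \<inter> \<pp> = {}}"
  by (rule bij_betw_byWitness[where f' = extension])
    (auto simp: Spec_def extension_contraction contraction_extension primeideal.axioms(1)
      intro: primeideal_contraction primeideal_extension dest: contraction_disjoint)

end

section \<open>Zariski topology\<close>

definition zero_locus :: "('a, 'b) ring_scheme \<Rightarrow> 'a set \<Rightarrow> 'a set set" where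
  "zero_locus R E = {\<pp> \<in> Spec R. E \<subseteq> \<pp>}"

text \<open>Primality in contrapositive form: elements of E and of F outside \<pp> have a product
  outside \<pp>. The pairwise products replace the product of the generated ideals, which has the
  same locus.\<close>

lemma zero_locus_Un:
  assumes "cring R" "E \<subseteq> carrier R" "F \<subseteq> carrier R"
  shows "zero_locus R E \<union> zero_locus R F = zero_locus R {a \<otimes>\<^bsub>R\<^esub> b | a b. a \<in> E \<and> b \<in> F}"
proof -
  have "(E \<subseteq> \<pp> \<or> F \<subseteq> \<pp>) \<longleftrightarrow> {a \<otimes>\<^bsub>R\<^esub> b | a b. a \<in> E \<and> b \<in> F} \<subseteq> \<pp>" if "primeideal \<pp> R" for \<pp>
  proof -
    interpret primeideal \<pp> R by fact
    show ?thesis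
    proof
      show "{a \<otimes>\<^bsub>R\<^esub> b | a b. a \<in> E \<and> b \<in> F} \<subseteq> \<pp>" if "E \<subseteq> \<pp> \<or> F \<subseteq> \<pp>"
        using that assms(2,3) I_l_closed I_r_closed by blast
      show "E \<subseteq> \<pp> \<or> F \<subseteq> \<pp>" if sub: "{a \<otimes>\<^bsub>R\<^esub> b | a b. a \<in> E \<and> b \<in> F} \<subseteq> \<pp>"
      proof (rule ccontr)
        assume "\<not> (E \<subseteq> \<pp> \<or> F \<subseteq> \<pp>)"
        then obtain a b where ab: "a \<in> E" "a \<notin> \<pp>" "b \<in> F" "b \<notin> \<pp>"
          by blast
        then have "a \<otimes>\<^bsub>R\<^esub> b \<in> \<pp>"
          using sub by blast
        then show False
          using ab assms(2,3) I_prime by blast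
      qed
    qed
  qed
  then show ?thesis
    unfolding zero_locus_def Spec_def by blast
qed

text \<open>Since \<open>zariski\<close> is given through \<open>topology\<close>, its open sets are
  the intended ones only once \<open>istopology\<close> is checked. On complements, intersections
  become loci of products and unions become loci of unions.\<close>

lemma openin_zariski:
  assumes "cring R"
  shows "openin (zariski R) U \<longleftrightarrow> (\<exists>E \<subseteq> carrier R. U = Spec R - zero_locus R E)"
proof -
  interpret cring R by fact
  have "istopology (\<lambda>U. \<exists>E \<subseteq> carrier R. U = Spec R - zero_locus R E)"
    unfolding istopology_def
  proof (intro conjI allI impI)
    fix U V
    assume "\<exists>E \<subseteq> carrier R. U = Spec R - zero_locus R E" "\<exists>E \<subseteq> carrier R. V = Spec R - zero_locus R E"
    then obtain E F where E: "E \<subseteq> carrier R" "U = Spec R - zero_locus R E"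
      and F: "F \<subseteq> carrier R" "V = Spec R - zero_locus R F"
      by blast
    have "U \<inter> V = Spec R - zero_locus R {a \<otimes>\<^bsub>R\<^esub> b | a b. a \<in> E \<and> b \<in> F}"
      unfolding E(2) F(2) zero_locus_Un[OF assms E(1) F(1), symmetric] by blast
    moreover have "{a \<otimes>\<^bsub>R\<^esub> b | a b. a \<in> E \<and> b \<in> F} \<subseteq> carrier R"
      using E(1) F(1) m_closed by blast
    ultimately show "\<exists>E \<subseteq> carrier R. U \<inter> V = Spec R - zero_locus R E"
      by blast
  next
    fix \<K>
    assume "\<forall>K \<in> \<K>. \<exists>E \<subseteq> carrier R. K = Spec R - zero_locus R E"
    then obtain E where E: "\<And>K. K \<in> \<K> \<Longrightarrow> E K \<subseteq> carrier R \<and> K = Spec R - zero_locus R (E K)"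
      by metis
    then have "\<Union>\<K> = (\<Union>K \<in> \<K>. Spec R - zero_locus R (E K))"
      by auto
    also have "\<dots> = Spec R - zero_locus R (\<Union>K \<in> \<K>. E K)"
      by (auto simp: zero_locus_def)
    finally show "\<exists>E \<subseteq> carrier R. \<Union>\<K> = Spec R - zero_locus R E"
      using E by (intro exI[of _ "\<Union>K \<in> \<K>. E K"]) blast
  qed
  then show ?thesis
    by (simp add: zariski_def zero_locus_def)
qed

lemma topspace_zariski:
  assumes "cring R"
  shows "topspace (zariski R) = Spec R"
proof
  show "topspace (zariski R) \<subseteq> Spec R"
    using openin_zariski[OF assms] openin_topspace[of "zariski R"] by blast
  \<comment> \<open>Primes are proper; so the choice of the whole carrier for E exhibits the whole
    spectrum as open.\<close>
  have "zero_locus R (carrier R) = {}"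
  proof -
    have "\<not> carrier R \<subseteq> \<pp>" if "primeideal \<pp> R" for \<pp>
    proof -
      interpret primeideal \<pp> R by fact
      show ?thesis using a_subset I_notcarr by blast
    qed
    then show ?thesis by (auto simp: zero_locus_def Spec_def)
  qed
  then have "openin (zariski R) (Spec R)"
    using openin_zariski[OF assms] by blast
  then show "Spec R \<subseteq> topspace (zariski R)"
    by (rule openin_subset)
qed

section \<open>The spectrum of the localization as a subspace\<close>

context ring_localization_setting
begin

text \<open>Contraction is already bijective onto the primes avoiding S, so only closed sets have to
  be matched: loci in R pull back to loci in L, and loci in L are carried to traces of loci in
  R.\<close>

lemma homeomorphic_map_contraction:
  "homeomorphic_map (zariski L) (subtopology (zariski R) {\<pp> \<in> Spec R. S \<inter> \<pp> = {}}) (contraction R S)"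
    (is "homeomorphic_map _ (subtopology _ ?Y) _")
proof (rule bijective_open_imp_homeomorphic_map)
  note top = topspace_zariski[OF R.is_cring] topspace_zariski[OF cring_ring_localization]
  have topY: "topspace (subtopology (zariski R) ?Y) = ?Y"
    by (auto simp: top)
  have img: "contraction R S ` Spec L = ?Y" and inj: "inj_on (contraction R S) (Spec L)"
    using bij_betw_contraction by (auto simp: bij_betw_def)
  show "contraction R S ` topspace (zariski L) = topspace (subtopology (zariski R) ?Y)"
    unfolding topY top by (rule img)
  show "inj_on (contraction R S) (topspace (zariski L))"
    unfolding top by (rule inj)
  \<comment> \<open>E is replaced by all numerators of all representatives of its elements; by
    \<open>frac_mem_ideal_iff\<close>, r/s lies in \<qq> iff r lies in the contraction.\<close>
  have mem: "contraction R S \<qq> \<in> zero_locus R {r \<in> carrier R. \<exists>s \<in> S. frac r s \<in> E} \<longleftrightarrow> \<qq> \<in> zero_locus L E"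
    if "\<qq> \<in> Spec L" "E \<subseteq> carrier L" for \<qq> E
  proof -
    interpret primeideal \<qq> L using that by (simp add: Spec_def)
    have "x \<in> \<qq>" if x: "x \<in> E" and all: "\<forall>r \<in> carrier R. \<forall>s \<in> S. frac r s \<in> E \<longrightarrow> frac r s \<in> \<qq>" for x
    proof -
      have "x \<in> carrier L"
        using x \<open>E \<subseteq> carrier L\<close> by blast
      then obtain r s where "r \<in> carrier R" "s \<in> S" "x = frac r s"
        by (rule fracE)
      then show ?thesis
        using x all by blast
    qed
    then have "E \<subseteq> \<qq> \<longleftrightarrow> (\<forall>r \<in> carrier R. \<forall>s \<in> S. frac r s \<in> E \<longrightarrow> frac r s \<in> \<qq>)"
      by blast
    also have "\<dots> \<longleftrightarrow> (\<forall>r \<in> carrier R. \<forall>s \<in> S. frac r s \<in> E \<longrightarrow> frac r \<one> \<in> \<qq>)"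
      using frac_mem_ideal_iff[OF ideal_axioms] by blast
    also have "\<dots> \<longleftrightarrow> {r \<in> carrier R. \<exists>s \<in> S. frac r s \<in> E} \<subseteq> contraction R S \<qq>"
      by (auto simp: contraction_def)
    finally show ?thesis
      using that img by (auto simp: zero_locus_def)
  qed
  have mem': "contraction R S \<qq> \<in> zero_locus R E \<longleftrightarrow> \<qq> \<in> zero_locus L ((\<lambda>r. frac r \<one>) ` E)"
    if "\<qq> \<in> Spec L" "E \<subseteq> carrier R" for \<qq> E
    using that img by (auto simp: zero_locus_def contraction_def)
  show "continuous_map (zariski L) (subtopology (zariski R) ?Y) (contraction R S)"
    unfolding continuous_map_in_subtopology
  proof (intro conjI)
    show "contraction R S \<in> topspace (zariski L) \<rightarrow> ?Y"
      unfolding top using img by blast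
    show "continuous_map (zariski L) (zariski R) (contraction R S)"
      unfolding continuous_map_def top
    proof (intro conjI allI impI)
      show "contraction R S \<in> Spec L \<rightarrow> Spec R"
        using img by blast
      fix U assume "openin (zariski R) U"
      then obtain E where E: "E \<subseteq> carrier R" "U = Spec R - zero_locus R E"
        using openin_zariski[OF R.is_cring] by blast
      have "{\<qq> \<in> Spec L. contraction R S \<qq> \<in> U} = Spec L - zero_locus L ((\<lambda>r. frac r \<one>) ` E)"
        using mem'[OF _ E(1)] img unfolding E(2) by blast
      moreover have "(\<lambda>r. frac r \<one>) ` E \<subseteq> carrier L"
        using E(1) by auto
      ultimately show "openin (zariski L) {\<qq> \<in> Spec L. contraction R S \<qq> \<in> U}"
        using openin_zariski[OF cring_ring_localization] by blast
    qed
  qed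
  show "open_map (zariski L) (subtopology (zariski R) ?Y) (contraction R S)"
    unfolding open_map_def
  proof (intro allI impI)
    fix U assume "openin (zariski L) U"
    then obtain E where E: "E \<subseteq> carrier L" "U = Spec L - zero_locus L E"
      using openin_zariski[OF cring_ring_localization] by blast
    let ?E = "{r \<in> carrier R. \<exists>s \<in> S. frac r s \<in> E}"
    \<comment> \<open>By \<open>mem\<close>, membership of \<qq> in U can be read off from its
      contraction, so any prime lying over \<pp> will do; surjectivity onto Y supplies one.\<close>
    have "contraction R S ` U = (Spec R - zero_locus R ?E) \<inter> ?Y"
    proof (intro equalityI subsetI)
      fix \<pp> assume "\<pp> \<in> contraction R S ` U"
      then show "\<pp> \<in> (Spec R - zero_locus R ?E) \<inter> ?Y"
        using mem[OF _ E(1)] img unfolding E(2) by blast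
    next
      fix \<pp> assume \<pp>: "\<pp> \<in> (Spec R - zero_locus R ?E) \<inter> ?Y"
      then obtain \<qq> where "\<qq> \<in> Spec L" "\<pp> = contraction R S \<qq>"
        using img by blast
      then show "\<pp> \<in> contraction R S ` U"
        using mem[OF _ E(1)] \<pp> unfolding E(2) by blast
    qed
    moreover have "openin (zariski R) (Spec R - zero_locus R ?E)"
      unfolding openin_zariski[OF R.is_cring] by (intro exI[of _ ?E]) simp
    ultimately show "openin (subtopology (zariski R) ?Y) (contraction R S ` U)"
      unfolding openin_subtopology by blast
  qed
qed

end

section \<open>The isomorphisms for subspaces, localizations and local rings\<close>

theorem corollary4p13:
  shows
    "(\<forall>(X :: 'a topology) Y s.
        Y \<subseteq> topspace X \<and> (\<forall>P \<in> pixels X Y. s P \<in> P) \<longrightarrow>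
        (\<exists>F1. cat_isomorphism (Top (subtopology X Y)) (pixelation X (pixels X Y) s)
                (\<lambda>Z. pixel X Y Z) F1)) \<and>
     (\<forall>(R :: ('b, 'c) ring_scheme) S Y s.
        cring R \<and> submonoid S R \<and> Y = {\<pp> \<in> Spec R. S \<inter> \<pp> = {}} \<and>
        (\<forall>P \<in> pixels (zariski R) Y. s P \<in> P) \<longrightarrow>
        homeomorphic_map (zariski (ring_localization R S)) (subtopology (zariski R) Y)
          (contraction R S) \<and>
        (\<exists>F1. cat_isomorphism (TS (ring_localization R S)) (pixelation (zariski R) (pixels (zariski R) Y) s)
                (\<lambda>U. pixel (zariski R) Y (contraction R S ` U)) F1)) \<and>
     (\<forall>(R :: ('b, 'c) ring_scheme) \<pp> S Y s.
        cring R \<and> \<pp> \<in> Spec R \<and> S = carrier R - \<pp> \<and> Y = {\<qq> \<in> Spec R. \<qq> \<subseteq> \<pp>} \<and>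
        (\<forall>P \<in> pixels (zariski R) Y. s P \<in> P) \<longrightarrow>
        homeomorphic_map (zariski (prime_localization R \<pp>)) (subtopology (zariski R) Y)
          (contraction R S) \<and>
        (\<exists>F1. cat_isomorphism (TS (prime_localization R \<pp>)) (pixelation (zariski R) (pixels (zariski R) Y) s)
                (\<lambda>U. pixel (zariski R) Y (contraction R S ` U)) F1))"
proof (intro conjI allI impI; elim conjE)
  fix X :: "'a topology" and Y s
  assume "\<forall>P \<in> pixels X Y. s P \<in> P"
  then show "\<exists>F1. cat_isomorphism (Top (subtopology X Y)) (pixelation X (pixels X Y) s)
      (\<lambda>Z. pixel X Y Z) F1"
    using Top_isomorphism_pixelation[of X Y s "subtopology X Y" id] by simp
next
  fix R :: "('b, 'c) ring_scheme" and S Y s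
  assume "cring R" "submonoid S R" and Y: "Y = {\<pp> \<in> Spec R. S \<inter> \<pp> = {}}"
    and s: "\<forall>P \<in> pixels (zariski R) Y. s P \<in> P"
  then interpret ring_localization_setting R S
    by (simp add: ring_localization_setting_def)
  show h: "homeomorphic_map (zariski (ring_localization R S)) (subtopology (zariski R) Y) (contraction R S)"
    unfolding Y by (rule homeomorphic_map_contraction)
  show "\<exists>F1. cat_isomorphism (TS (ring_localization R S)) (pixelation (zariski R) (pixels (zariski R) Y) s)
      (\<lambda>U. pixel (zariski R) Y (contraction R S ` U)) F1"
    by (rule Top_isomorphism_pixelation[OF s h])
next
  fix R :: "('b, 'c) ring_scheme" and \<pp> S Y s
  assume "cring R" "\<pp> \<in> Spec R" and S: "S = carrier R - \<pp>" and Y: "Y = {\<qq> \<in> Spec R. \<qq> \<subseteq> \<pp>}"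
    and s: "\<forall>P \<in> pixels (zariski R) Y. s P \<in> P"
  interpret primeideal \<pp> R
    using \<open>\<pp> \<in> Spec R\<close> by (simp add: Spec_def)
  \<comment> \<open>Properness of \<pp> puts 1 into S, and primality makes S closed under
    products.\<close>
  have "submonoid S R"
    unfolding S using I_prime one_imp_carrier I_notcarr by unfold_locales auto
  then interpret ring_localization_setting R S
    using \<open>cring R\<close> by (simp add: ring_localization_setting_def)
  \<comment> \<open>S is a complement inside the carrier, so the equivalence rests on \<qq> being a
    subset of the carrier.\<close>
  have "\<qq> \<subseteq> \<pp> \<longleftrightarrow> S \<inter> \<qq> = {}" if "\<qq> \<in> Spec R" for \<qq>
  proof -
    have "\<qq> \<subseteq> carrier R"
      using that by (simp add: Spec_def primeideal_def ideal_def additive_subgroup.a_subset)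
    then show ?thesis
      unfolding S by blast
  qed
  then have Y': "Y = {\<qq> \<in> Spec R. S \<inter> \<qq> = {}}"
    unfolding Y by blast
  show h: "homeomorphic_map (zariski (prime_localization R \<pp>)) (subtopology (zariski R) Y) (contraction R S)"
    unfolding Y' prime_localization_def S[symmetric] by (rule homeomorphic_map_contraction)
  show "\<exists>F1. cat_isomorphism (TS (prime_localization R \<pp>)) (pixelation (zariski R) (pixels (zariski R) Y) s)
      (\<lambda>U. pixel (zariski R) Y (contraction R S ` U)) F1"
    by (rule Top_isomorphism_pixelation[OF s h])
qed

end
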